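(* Let $\mathcal{A}^\star$ be the mod 2 motivic Steenrod algebra over a base scheme with no points of residue characteristic two, let $\operatorname{Sq}^{i}$ be the motivic Steenrod squares, let $Q_i$ and $\mathcal{P}^i$ in $\mathcal{A}^\star$ be the elements of the Milnor basis dual to $\tau_i$ and $\xi_i$ respectively, and let $\tau\in H^{0,1}$ be the generator and $\rho\in H^{1,1}$ the class of $-1$. Then for every integer $n\ge 1$ the following equality holds in $\mathcal{A}^\star$: \[ \begin{aligned} {}[\mathcal{P}^n, \operatorname{Sq}^{2^{n+1}}] = {}& \mathcal{P}^{n+1} + \tau Q_n Q_0 \operatorname{Sq}^{2^{n+1} - 2} \\ & + \sum_{i=0}^{n-1}\tau\rho^i\, Q_{n-i-1}Q_{n-i}\cdots Q_n \big(\operatorname{Sq}^{2^{n-i}} + \rho\, Q_0 \operatorname{Sq}^{2^{n-i} - 2}\big), \end{aligned} \] where $[A,B]:=AB-BA$ and $Q_{n-i-1}Q_{n-i}\cdots Q_n$ denotes the product of all $Q_j$ with $n-i-1\le j\le n$. (Together with $\mathcal{P}^1=\operatorname{Sq}^2$ this computes the $\mathcal{P}^n$ recursively.)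
   Context: Base: a base scheme $S$ with no points of residue characteristic two (for instance $S=\operatorname{Spec} k$, $k$ a field with $\operatorname{char} k\neq 2$, or an essentially smooth scheme over such a field). $H^\star=H^{\star}(S;\mathbb{Z}/2)$ is the bigraded mod 2 motivic cohomology of the base, and $H_\star:=H^{-\star}$. $\tau$ is the generator of $H^{0,1}$ (over a field $H^{0,1}\cong\mu_2(k)$), and $\rho\in H^{1,1}$ is the class of $-1$ (over a field $H^{1,1}\cong k^\times/(k^\times)^2$). The mod 2 motivic Steenrod algebra $\mathcal{A}^\star$ is the $H^\star$-algebra of bistable operations on mod 2 motivic cohomology; it is generated over $H^\star$ by the motivic Steenrod squares $\operatorname{Sq}^i$ ($\operatorname{Sq}^0=1$, $\operatorname{Sq}^1$ the Bockstein), and is a free left $H^\star$-module on the admissible monomials in the $\operatorname{Sq}^i$. Its dual is $\mathcal{A}_\star:=\operatorname{Hom}(\mathcal{A}^\star,H^\star)$ (left $H^\star$-linear maps), and \[ \mathcal{A}_\star \cong H_\star[\tau_0,\tau_1,\ldots,\xi_1,\xi_2,\ldots]\big/\big(\tau_i^2+\tau\xi_{i+1}+\rho(\tau_{i+1}+\tau_0\xi_{i+1}),\ i\ge 0\big), \] with $|\tau_i|=(2^{i+1}-1,2^i-1)$ and $|\xi_i|=(2^{i+1}-2,2^i-1)$. It is a Hopf algebroid with $\eta_L(x)=\eta_R(x)=x$ for $x\in H^{1,1}=H_{-1,-1}$, $\eta_L\tau=\tau$, $\eta_R\tau=\tau+\rho\tau_0$, $\epsilon\tau_i=0$ for $i\geq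 0$, $\epsilon\xi_i=0$ for $i\geq 1$, $\Delta x = x\otimes 1$ for $x\in H_\star$, and, with $\xi_0=1$, \[ \Delta\xi_k=\sum_{i=0}^k\xi_{k-i}^{2^i}\otimes\xi_i,\qquad \Delta\tau_k=\tau_k\otimes 1+\sum_{i=0}^k\xi_{k-i}^{2^i}\otimes\tau_i . \] Here $\Delta:\mathcal{A}_\star\to\mathcal{A}_\star\otimes_{r,l}\mathcal{A}_\star$, the tensor product using the right module structure (via $\eta_R$) on the first factor and the left one (via $\eta_L$) on the second. With $\langle\alpha,\theta\rangle:=\alpha(\theta)\in H^\star$, the product of $\mathcal{A}^\star$ is related to $\Delta$ by $\langle\alpha,\theta_1\theta_2\rangle=[\Delta\alpha,\theta_1\otimes\theta_2]$, where $[\alpha_1\otimes\alpha_2,\theta_1\otimes\theta_2]:=\langle\alpha_1,\theta_1\langle\alpha_2,\theta_2\rangle\rangle$ (this pairing bracket is not the commutator). $\mathcal{A}_\star$ is a free left $H_\star$-module on the monomials $\tau(E)\xi(R)=\prod_i\tau_i^{\epsilon_i}\prod_i\xi_i^{r_i}$, where $E=(\epsilon_0,\epsilon_1,\dots)$ with $\epsilon_i\in\{0,1\}$ and $R=(r_1,r_2,\dots)$ with $r_i\ge0$ are finite sequences. The dual basis $\{\widehat{\tau(E)\xi(R)}\}$ of $\mathcal{A}^\star$ is called the Milnor basis. Set $Q_i:=\widehat{\tau_i}$, $\mathcal{P}^R:=\widehat{\xi(R)}$ for a sequence $R$, and $\mathcal{P}^i:=\widehat{\xi_i}$ for an integer $i\ge1$.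 Known facts: $Q_0=\operatorname{Sq}^1$, $\operatorname{Sq}^{2m}=\widehat{\xi_1^m}$ (so $\mathcal{P}^1=\operatorname{Sq}^2$), $\widehat{\tau(E)\xi(R)}=\big(\prod_i Q_i^{\epsilon_i}\big)\mathcal{P}^R$, $Q_iQ_j=Q_jQ_i$ and $Q_i^2=0$. *)

theory Defs
  imports Complex_Main "HOL-Library.Poly_Mapping"
begin

text \<open>
  Motivic cohomology itself is not available, so the mod 2 motivic Steenrod algebra and its dual are
  described by the structure they carry over every base scheme without points of residue
  characteristic two: the bigraded coefficient ring \<open>H\<close>, the Hopf algebroid \<open>\<A>\<^sub>\<star>\<close>,
  and the algebra \<open>\<A>\<^sup>\<star>\<close> paired with it. The type variables are
  \<open>'h\<close> for \<open>H\<close>, \<open>'a\<close> for \<open>\<A>\<^sub>\<star>\<close>, \<open>'t\<close> for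
  \<open>\<A>\<^sub>\<star> \<otimes>\<^bsub>r,l\<^esub> \<A>\<^sub>\<star>\<close> and \<open>'s\<close> for
  \<open>\<A>\<^sup>\<star>\<close>.
\<close>

subsection \<open>Rings, modules, tensor products\<close>

definition unital_ring_hom :: "('x::ring_1 \<Rightarrow> 'y::ring_1) \<Rightarrow> bool" where
  "unital_ring_hom f \<longleftrightarrow>
     f 1 = 1 \<and> (\<forall>x y. f (x + y) = f x + f y) \<and> (\<forall>x y. f (x * y) = f x * f y)"

definition free_basis ::
    "('h::comm_ring_1 \<Rightarrow> 'm::ab_group_add \<Rightarrow> 'm) \<Rightarrow> 'i set \<Rightarrow> ('i \<Rightarrow> 'm) \<Rightarrow> bool" where
  "free_basis scale I b \<longleftrightarrow> module scale \<and> inj_on b I \<and>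
     \<not> module.dependent scale (b ` I) \<and> module.span scale (b ` I) = UNIV"

locale bigraded_ring =
  fixes H :: "int \<Rightarrow> int \<Rightarrow> 'h::comm_ring_1 set"
  assumes zero_mem: "0 \<in> H p q"
    and diff_mem: "x \<in> H p q \<Longrightarrow> y \<in> H p q \<Longrightarrow> x - y \<in> H p q"
    and one_mem: "1 \<in> H 0 0"
    and mult_mem: "x \<in> H p q \<Longrightarrow> y \<in> H p' q' \<Longrightarrow> x * y \<in> H (p + p') (q + q')"
    and direct_sum: "\<exists>!c. finite {d. c d \<noteq> 0} \<and> (\<forall>p q. c (p, q) \<in> H p q) \<and> x = (\<Sum>d | c d \<noteq> 0. c d)"

text \<open>
  The subgroup of the free abelian group on \<open>'a \<times> 'a\<close> that is divided out to form the tensor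
  product over \<open>'h\<close>, where \<open>'h\<close> acts on the first factor through \<open>etaR\<close> and on the
  second one through \<open>etaL\<close>.
\<close>

inductive_set balanced_relations ::
    "('h \<Rightarrow> 'a::comm_ring_1) \<Rightarrow> ('h \<Rightarrow> 'a) \<Rightarrow> (('a \<times> 'a) \<Rightarrow>\<^sub>0 int) set"
  for etaL etaR :: "'h \<Rightarrow> 'a" where
  zero: "0 \<in> balanced_relations etaL etaR"
| diff: "u \<in> balanced_relations etaL etaR \<Longrightarrow> v \<in> balanced_relations etaL etaR \<Longrightarrow>
    u - v \<in> balanced_relations etaL etaR"
| add_left: "frag_of (a + a', b) - frag_of (a, b) - frag_of (a', b) \<in> balanced_relations etaL etaR"
| add_right: "frag_of (a, b + b') - frag_of (a, b) - frag_of (a, b') \<in> balanced_relations etaL etaR"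
| balance: "frag_of (a * etaR h, b) - frag_of (a, etaL h * b) \<in> balanced_relations etaL etaR"

text \<open>
  \<open>'t\<close> is the ring \<open>'a \<otimes>\<^bsub>r,l\<^esub> 'a\<close>. Since \<open>- tensor a b = tensor (- a) b\<close>, lists of pairs
  represent all elements of the tensor product.
\<close>

locale balanced_tensor_product =
  fixes etaL etaR :: "'h::comm_ring_1 \<Rightarrow> 'a::comm_ring_1"
    and tensor :: "'a \<Rightarrow> 'a \<Rightarrow> 't::comm_ring_1"
  assumes tensor_add_left: "tensor (a + a') b = tensor a b + tensor a' b"
    and tensor_add_right: "tensor a (b + b') = tensor a b + tensor a b'"
    and tensor_balanced: "tensor (a * etaR h) b = tensor a (etaL h * b)"
    and tensor_generate: "\<exists>ps. z = (\<Sum>(a, b)\<leftarrow>ps. tensor a b)"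
    and tensor_kernel: "(\<Sum>(a, b)\<leftarrow>ps. tensor a b) = 0 \<Longrightarrow>
          (\<Sum>p\<leftarrow>ps. frag_of p) \<in> balanced_relations etaL etaR"
    and tensor_one: "tensor 1 1 = 1"
    and tensor_mult: "tensor a b * tensor a' b' = tensor (a * a') (b * b')"

subsection \<open>Milnor monomials\<close>

text \<open>
  A pair \<open>(E, R)\<close> encodes two finite sequences: \<open>E\<close> is the set of indices with
  \<open>\<epsilon>\<^sub>i = 1\<close>, and \<open>R i\<close> is the exponent of \<open>\<xi>\<^sub>i\<close>. As \<open>\<xi>\<^sub>0 = 1\<close> is not a
  generator, \<open>R 0 = 0\<close>.
\<close>

definition milnor_indices :: "(nat set \<times> (nat \<Rightarrow> nat)) set" where
  "milnor_indices = {(E, R). finite E \<and> finite {i. R i \<noteq> 0} \<and> R 0 = 0}"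

definition milnor_monomial ::
    "(nat \<Rightarrow> 'a::comm_ring_1) \<Rightarrow> (nat \<Rightarrow> 'a) \<Rightarrow> nat set \<times> (nat \<Rightarrow> nat) \<Rightarrow> 'a" where
  "milnor_monomial taus xi = (\<lambda>(E, R). (\<Prod>i\<in>E. taus i) * (\<Prod>i | R i \<noteq> 0. xi i ^ R i))"

text \<open>The sequence of exponents of \<open>\<xi>\<^sub>i\<^sup>m\<close>.\<close>

definition xi_power :: "nat \<Rightarrow> nat \<Rightarrow> nat \<Rightarrow> nat" where
  "xi_power i m = (\<lambda>j. if j = i then m else 0)"

subsection \<open>The dual motivic Steenrod algebra\<close>

text \<open>
  \<open>H\<^sub>\<star>\<close> is \<open>H\<^sup>\<star>\<close> with negated degrees, so both are the same ring \<open>'h\<close>.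
  The relations together with the freeness on the monomials \<open>\<tau>(E)\<xi>(R)\<close> amount to
  the presentation of \<open>\<A>\<^sub>\<star>\<close>: the relations reduce every polynomial in the
  generators to a combination of these monomials, so by freeness there are no others.
\<close>

locale dual_motivic_steenrod_algebra =
  bigraded_ring H + balanced_tensor_product etaL etaR tensor
  for H :: "int \<Rightarrow> int \<Rightarrow> 'h::comm_ring_1 set"
    and etaL etaR :: "'h \<Rightarrow> 'a::comm_ring_1"
    and tensor :: "'a \<Rightarrow> 'a \<Rightarrow> 't::comm_ring_1" +
  fixes tau rho :: 'h
    and taus xi :: "nat \<Rightarrow> 'a"
    and eps :: "'a \<Rightarrow> 'h"
    and Delta :: "'a \<Rightarrow> 't"
  assumes char_two: "(1::'h) + 1 = 0"
    and tau_mem: "tau \<in> H 0 1"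
    and rho_mem: "rho \<in> H 1 1"
    and etaL_hom: "unital_ring_hom etaL"
    and etaR_hom: "unital_ring_hom etaR"
    and eps_hom: "unital_ring_hom eps"
    and Delta_hom: "unital_ring_hom Delta"
    and xi_zero: "xi 0 = 1"
    and taus_square: "(taus i)\<^sup>2 + etaL tau * xi (i + 1)
          + etaL rho * (taus (i + 1) + taus 0 * xi (i + 1)) = 0"
    and monomials_basis:
      "free_basis (\<lambda>h a. etaL h * a) milnor_indices (milnor_monomial taus xi)"
    and etaR_one_one: "h \<in> H 1 1 \<Longrightarrow> etaR h = etaL h"
    and etaR_tau: "etaR tau = etaL tau + etaL rho * taus 0"
    and eps_etaL: "eps (etaL h) = h"
    and eps_etaR: "eps (etaR h) = h"
    and eps_taus: "eps (taus i) = 0"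
    and eps_xi: "i \<ge> 1 \<Longrightarrow> eps (xi i) = 0"
    and Delta_etaL: "Delta (etaL h) = tensor (etaL h) 1"
    and Delta_etaR: "Delta (etaR h) = tensor 1 (etaR h)"
    and Delta_xi: "Delta (xi k) = (\<Sum>i\<le>k. tensor (xi (k - i) ^ (2 ^ i)) (xi i))"
    and Delta_taus: "Delta (taus k) =
          tensor (taus k) 1 + (\<Sum>i\<le>k. tensor (xi (k - i) ^ (2 ^ i)) (taus i))"

subsection \<open>The motivic Steenrod algebra\<close>

text \<open>
  \<open>iota\<close> is the (non-central) inclusion \<open>H\<^sup>\<star> \<rightarrow> \<A>\<^sup>\<star>\<close>, \<open>pair \<alpha> \<theta>\<close> is
  \<open>\<langle>\<alpha>, \<theta>\<rangle>\<close> and \<open>hat (E, R)\<close> is the element of the Milnor basis dual to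
  \<open>\<tau>(E)\<xi>(R)\<close>. In \<open>pair_mult\<close> the sum is \<open>[\<Delta>\<alpha>, \<theta>\<^sub>1 \<otimes> \<theta>\<^sub>2]\<close>, for any way of
  writing \<open>\<Delta>\<alpha>\<close> as a sum of tensors; by \<open>pair_right\<close> its value only depends on
  \<open>\<Delta>\<alpha>\<close>. \<open>Sq_odd\<close> is Voevodsky's definition of the odd squares as Bocksteins of
  the even ones.
\<close>

locale motivic_steenrod_algebra =
  dual_motivic_steenrod_algebra H etaL etaR tensor tau rho taus xi eps Delta
  for H :: "int \<Rightarrow> int \<Rightarrow> 'h::comm_ring_1 set"
    and etaL etaR :: "'h \<Rightarrow> 'a::comm_ring_1"
    and tensor :: "'a \<Rightarrow> 'a \<Rightarrow> 't::comm_ring_1"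
    and tau rho :: 'h
    and taus xi :: "nat \<Rightarrow> 'a"
    and eps :: "'a \<Rightarrow> 'h"
    and Delta :: "'a \<Rightarrow> 't" +
  fixes iota :: "'h \<Rightarrow> 's::ring_1"
    and pair :: "'a \<Rightarrow> 's \<Rightarrow> 'h"
    and hat :: "nat set \<times> (nat \<Rightarrow> nat) \<Rightarrow> 's"
    and Sq :: "nat \<Rightarrow> 's"
  assumes iota_hom: "unital_ring_hom iota"
    and pair_add_left: "pair (\<alpha> + \<beta>) \<theta> = pair \<alpha> \<theta> + pair \<beta> \<theta>"
    and pair_add_right: "pair \<alpha> (\<theta> + \<psi>) = pair \<alpha> \<theta> + pair \<alpha> \<psi>"
    and pair_etaL: "pair (etaL h * \<alpha>) \<theta> = h * pair \<alpha> \<theta>"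
    and pair_left: "pair \<alpha> (iota h * \<theta>) = h * pair \<alpha> \<theta>"
    and pair_right: "pair \<alpha> (\<theta> * iota h) = pair (\<alpha> * etaR h) \<theta>"
    and pair_one: "pair \<alpha> 1 = eps \<alpha>"
    and pair_mult: "Delta \<alpha> = (\<Sum>(a, b)\<leftarrow>ps. tensor a b) \<Longrightarrow>
          pair \<alpha> (\<theta>\<^sub>1 * \<theta>\<^sub>2) = (\<Sum>(a, b)\<leftarrow>ps. pair a (\<theta>\<^sub>1 * iota (pair b \<theta>\<^sub>2)))"
    and hat_dual: "M \<in> milnor_indices \<Longrightarrow> N \<in> milnor_indices \<Longrightarrow>
          pair (milnor_monomial taus xi M) (hat N) = (if M = N then 1 else 0)"
    and hat_basis: "free_basis (\<lambda>h \<theta>. iota h * \<theta>) milnor_indices hat"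
    and Sq_one: "Sq 1 = hat ({0}, \<lambda>_. 0)"
    and Sq_even: "Sq (2 * m) = hat ({}, xi_power 1 m)"
    and Sq_odd: "Sq (2 * m + 1) = Sq 1 * Sq (2 * m)"

definition milnor_Q :: "(nat set \<times> (nat \<Rightarrow> nat) \<Rightarrow> 's) \<Rightarrow> nat \<Rightarrow> 's" where
  "milnor_Q hat i = hat ({i}, \<lambda>_. 0)"

definition milnor_P :: "(nat set \<times> (nat \<Rightarrow> nat) \<Rightarrow> 's) \<Rightarrow> nat \<Rightarrow> 's" where
  "milnor_P hat i = hat ({}, xi_power i 1)"

definition commutator :: "'s::ring \<Rightarrow> 's \<Rightarrow> 's" where
  "commutator A B = A * B - B * A"

end

theory Submission
  imports Defs
begin

text \<open>
  An element of \<open>\<A>\<^sup>\<star>\<close> is determined by its pairings with the Milnor monomials. For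
  \<open>\<alpha> = \<xi>\<^sub>k\<beta>\<close> the pairings with \<open>\<P>\<^sup>nSq\<^sup>2\<^sup>m\<close> and \<open>Sq\<^sup>2\<^sup>m\<P>\<^sup>n\<close> satisfy almost the
  same recursion in \<open>(\<beta>, m)\<close>, because multiplication by \<open>\<xi>\<^sub>k\<close> is adjoint to lowering the
  exponent of \<open>\<xi>\<^sub>k\<close> in a dual monomial; in the commutator only the term giving
  \<open>\<P>\<^sup>n\<^sup>+\<^sup>1\<close> survives for \<open>k \<ge> 2\<close>, and \<open>\<xi>\<^sub>1\<close> just lowers \<open>m\<close>. This leaves the products
  \<open>\<tau>(E)\<close>. There \<open>\<P>\<^sup>nSq\<^sup>2\<^sup>m\<close> contributes only for \<open>E = {0, n}\<close>, through
  \<open>\<tau>\<^sub>0\<^sup>2 = \<tau>\<xi>\<^sub>1 + \<dots>\<close>, while for \<open>Sq\<^sup>2\<^sup>m\<P>\<^sup>n\<close> one has to extract \<open>\<xi>\<^sub>n\<close> from products of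
  \<open>\<tau>\<^sub>i\<close>s by \<open>\<tau>\<^sub>i\<^sup>2 = \<tau>\<xi>\<^sub>i\<^sub>+\<^sub>1 + \<rho>\<tau>\<^sub>i\<^sub>+\<^sub>1 + \<rho>\<tau>\<^sub>0\<xi>\<^sub>i\<^sub>+\<^sub>1\<close>. This is a chain of carries
  \<open>\<tau>\<^sub>j\<^sup>2 \<mapsto> \<rho>\<tau>\<^sub>j\<^sub>+\<^sub>1\<close>, \<open>\<tau>\<^sub>j\<^sub>+\<^sub>1\<^sup>2 \<mapsto> \<rho>\<tau>\<^sub>j\<^sub>+\<^sub>2\<close>, and so on up to \<open>\<tau>\<^sub>n\<^sub>-\<^sub>1\<^sup>2 \<mapsto> \<tau>\<xi>\<^sub>n\<close>,
  which accounts for the powers of \<open>\<rho>\<close> and for the intervals \<open>E = {j..n}\<close>.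
\<close>

lemma unital_ring_hom_one: "unital_ring_hom f \<Longrightarrow> f 1 = 1"
  and unital_ring_hom_add: "unital_ring_hom f \<Longrightarrow> f (x + y) = f x + f y"
  and unital_ring_hom_mult: "unital_ring_hom f \<Longrightarrow> f (x * y) = f x * f y"
  by (auto simp: unital_ring_hom_def)

lemma unital_ring_hom_zero: "unital_ring_hom f \<Longrightarrow> f 0 = 0"
  using unital_ring_hom_add[of f 0 0] by simp

lemma unital_ring_hom_power: "unital_ring_hom f \<Longrightarrow> f (x ^ n) = f x ^ n"
  by (induction n) (simp_all add: unital_ring_hom_one unital_ring_hom_mult)

lemma unital_ring_hom_prod:
  fixes f :: "'x::comm_ring_1 \<Rightarrow> 'y::comm_ring_1"
  shows "unital_ring_hom f \<Longrightarrow> f (prod g A) = (\<Prod>x\<in>A. f (g x))"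
  by (induction A rule: infinite_finite_induct)
     (simp_all add: unital_ring_hom_one unital_ring_hom_mult)

lemma additive_zero:
  fixes f :: "'a::monoid_add \<Rightarrow> 'b::ab_group_add"
  assumes "\<And>x y. f (x + y) = f x + f y"
  shows "f 0 = 0"
  using assms[of 0 0] by simp

lemma additive_uminus:
  fixes f :: "'a::ab_group_add \<Rightarrow> 'b::ab_group_add"
  assumes "\<And>x y. f (x + y) = f x + f y"
  shows "f (- x) = - f x"
proof -
  have "f x + f (- x) = f 0" using assms[of x "- x"] by simp
  also have "f 0 = 0" using assms by (rule additive_zero)
  finally show ?thesis by (simp add: add_eq_0_iff)
qed

lemma additive_sum:
  fixes f :: "'a::ab_group_add \<Rightarrow> 'b::ab_group_add"
  shows "(\<And>x y. f (x + y) = f x + f y) \<Longrightarrow> f (sum g A) = (\<Sum>x\<in>A. f (g x))"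
  by (induction A rule: infinite_finite_induct) (simp_all add: additive_zero)

lemma additive_sum_list:
  fixes f :: "'a::ab_group_add \<Rightarrow> 'b::ab_group_add"
  shows "(\<And>x y. f (x + y) = f x + f y) \<Longrightarrow> f (sum_list xs) = (\<Sum>x\<leftarrow>xs. f x)"
  by (induction xs) (simp_all add: additive_zero)

text \<open>
  The congruence modulo the largest ideal on which the additive map \<open>L\<close> vanishes.
\<close>

definition mult_equiv :: "('a::comm_monoid_mult \<Rightarrow> 'b) \<Rightarrow> 'a \<Rightarrow> 'a \<Rightarrow> bool" where
  "mult_equiv L u v \<longleftrightarrow> (\<forall>z. L (u * z) = L (v * z))"

lemma mult_equivD: "mult_equiv L u v \<Longrightarrow> L u = L v"
  unfolding mult_equiv_def by (metis mult.right_neutral)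

lemma mult_equiv_mult:
  "mult_equiv L u v \<Longrightarrow> mult_equiv L u' v' \<Longrightarrow> mult_equiv L (u * u') (v * v')"
  unfolding mult_equiv_def by (metis mult.assoc mult.commute)

lemma mult_equiv_power: "mult_equiv L u v \<Longrightarrow> mult_equiv L (u ^ k) (v ^ k)"
  by (induction k) (auto intro: mult_equiv_mult simp: mult_equiv_def[of _ 1])

lemma mult_equiv_prod:
  "(\<And>i. mult_equiv L (f i) (g i)) \<Longrightarrow> mult_equiv L (prod f A) (prod g A)"
  by (induction A rule: infinite_finite_induct)
     (auto intro: mult_equiv_mult simp: mult_equiv_def[of _ 1])

lemma xi_power_apply: "xi_power k m j = (if j = k then m else 0)"
  by (simp add: xi_power_def)

lemma xi_power_0: "xi_power k 0 = (\<lambda>_. 0)"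
  by (auto simp: xi_power_def)

lemma xi_power_upd: "(xi_power k m)(k := r) = xi_power k r"
  by (auto simp: xi_power_def)

lemma xi_power_eq_iff: "xi_power k m = xi_power k m' \<longleftrightarrow> m = m'"
  by (metis xi_power_apply)

lemma zero_eq_xi_power: "(\<lambda>_. 0) = xi_power k m \<longleftrightarrow> m = 0"
  using xi_power_eq_iff[of k 0 m] by (auto simp: xi_power_0)

context balanced_tensor_product
begin

lemma tensor_induct:
  assumes "\<And>a b. P (tensor a b)" "P 0" "\<And>u v. P u \<Longrightarrow> P v \<Longrightarrow> P (u + v)"
  shows "P z"
proof -
  obtain ps where "z = (\<Sum>(a, b)\<leftarrow>ps. tensor a b)"
    using tensor_generate by blast
  moreover have "P (\<Sum>(a, b)\<leftarrow>ps. tensor a b)"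
    by (induction ps) (auto intro: assms)
  ultimately show ?thesis by simp
qed

lemma tensor_sum_eq_imp_sum_eq:
  fixes g :: "'a \<Rightarrow> 'a \<Rightarrow> 'b::ring_1"
  assumes add_left: "\<And>a a' b. g (a + a') b = g a b + g a' b"
    and add_right: "\<And>a b b'. g a (b + b') = g a b + g a b'"
    and balanced: "\<And>a b h. g (a * etaR h) b = g a (etaL h * b)"
    and eq: "(\<Sum>(a, b)\<leftarrow>ps. tensor a b) = (\<Sum>(a, b)\<leftarrow>qs. tensor a b)"
  shows "(\<Sum>(a, b)\<leftarrow>ps. g a b) = (\<Sum>(a, b)\<leftarrow>qs. g a b)"
proof -
  define F :: "(('a \<times> 'a) \<Rightarrow>\<^sub>0 int) \<Rightarrow> 'b" where
    "F c = (\<Sum>p\<in>Poly_Mapping.keys c. of_int (Poly_Mapping.lookup c p) * g (fst p) (snd p))" for c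
  have F_superset: "F c = (\<Sum>p\<in>S. of_int (Poly_Mapping.lookup c p) * g (fst p) (snd p))"
    if "finite S" "Poly_Mapping.keys c \<subseteq> S" for S c
    unfolding F_def using that by (intro sum.mono_neutral_left) (auto simp: in_keys_iff)
  have F_add: "F (c + d) = F c + F d" for c d
  proof -
    let ?S = "Poly_Mapping.keys c \<union> Poly_Mapping.keys d"
    have "Poly_Mapping.keys (c + d) \<subseteq> ?S" by (rule Poly_Mapping.keys_add)
    then show ?thesis
      by (simp add: F_superset[of ?S] lookup_add algebra_simps sum.distrib)
  qed
  have F_diff: "F (c - d) = F c - F d" for c d
    using F_add[of "c - d" d] by simp
  have F_of: "F (frag_of p) = g (fst p) (snd p)" for p
    by (simp add: F_def)
  have F_kills: "F c = 0" if "c \<in> balanced_relations etaL etaR" for c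
    using that
    by induction (simp_all add: F_diff F_of add_left add_right balanced, simp add: F_def)
  define qs' where "qs' = map (\<lambda>(a, b). (- a, b)) qs"
  have tensor_qs': "(\<Sum>(a, b)\<leftarrow>qs'. tensor a b) = - (\<Sum>(a, b)\<leftarrow>qs. tensor a b)"
    unfolding qs'_def
    by (induction qs) (auto simp: additive_uminus[of "\<lambda>a. tensor a _", OF tensor_add_left])
  have g_qs': "(\<Sum>(a, b)\<leftarrow>qs'. g a b) = - (\<Sum>(a, b)\<leftarrow>qs. g a b)"
    unfolding qs'_def
    by (induction qs) (auto simp: additive_uminus[of "\<lambda>a. g a _", OF add_left])
  have "(\<Sum>(a, b)\<leftarrow>ps @ qs'. tensor a b) = 0"
    using tensor_qs' eq by simp
  from F_kills[OF tensor_kernel[OF this]] have "(\<Sum>(a, b)\<leftarrow>ps @ qs'. g a b) = 0"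
    by (simp add: additive_sum_list[of F, OF F_add] F_add F_of case_prod_unfold comp_def)
  then show ?thesis using g_qs' by simp
qed

lemma tensor_lift:
  fixes g :: "'a \<Rightarrow> 'a \<Rightarrow> 'b::ring_1"
  assumes "\<And>a a' b. g (a + a') b = g a b + g a' b"
    and "\<And>a b b'. g a (b + b') = g a b + g a b'"
    and "\<And>a b h. g (a * etaR h) b = g a (etaL h * b)"
  obtains L where "\<And>u v. L (u + v) = L u + L v" "\<And>a b. L (tensor a b) = g a b"
proof -
  define rep where "rep z = (SOME ps. z = (\<Sum>(a, b)\<leftarrow>ps. tensor a b))" for z
  have rep: "z = (\<Sum>(a, b)\<leftarrow>rep z. tensor a b)" for z
    unfolding rep_def by (rule someI_ex) (rule tensor_generate)
  define L where "L z = (\<Sum>(a, b)\<leftarrow>rep z. g a b)" for z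
  have L_eq: "L z = (\<Sum>(a, b)\<leftarrow>ps. g a b)" if "z = (\<Sum>(a, b)\<leftarrow>ps. tensor a b)" for z ps
  proof -
    have "(\<Sum>(a, b)\<leftarrow>rep z. tensor a b) = (\<Sum>(a, b)\<leftarrow>ps. tensor a b)"
      using rep[of z] that by simp
    with assms show ?thesis unfolding L_def by (rule tensor_sum_eq_imp_sum_eq)
  qed
  have "L (u + v) = L u + L v" for u v
  proof -
    have "u + v = (\<Sum>(a, b)\<leftarrow>rep u @ rep v. tensor a b)"
      using rep[of u] rep[of v] by simp
    from L_eq[OF this] show ?thesis by (simp add: L_def)
  qed
  moreover have "L (tensor a b) = g a b" for a b
    using L_eq[of "tensor a b" "[(a, b)]"] by simp
  ultimately show thesis using that by blast
qed

end


context motivic_steenrod_algebra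
begin

declare One_nat_def [simp del]

lemmas etaL_simps [simp] =
  unital_ring_hom_zero[OF etaL_hom] unital_ring_hom_one[OF etaL_hom]
  unital_ring_hom_add[OF etaL_hom] unital_ring_hom_mult[OF etaL_hom]
  unital_ring_hom_power[OF etaL_hom]

lemmas etaR_simps [simp] =
  unital_ring_hom_zero[OF etaR_hom] unital_ring_hom_one[OF etaR_hom]
  unital_ring_hom_add[OF etaR_hom] unital_ring_hom_mult[OF etaR_hom]
  unital_ring_hom_power[OF etaR_hom]

lemmas eps_simps [simp] =
  unital_ring_hom_zero[OF eps_hom] unital_ring_hom_one[OF eps_hom]
  unital_ring_hom_add[OF eps_hom] unital_ring_hom_mult[OF eps_hom]
  unital_ring_hom_power[OF eps_hom] unital_ring_hom_prod[OF eps_hom]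

lemmas Delta_simps =
  unital_ring_hom_one[OF Delta_hom] unital_ring_hom_mult[OF Delta_hom]
  unital_ring_hom_power[OF Delta_hom] unital_ring_hom_prod[OF Delta_hom]

lemmas iota_simps [simp] =
  unital_ring_hom_zero[OF iota_hom] unital_ring_hom_one[OF iota_hom]

lemmas pair_zero_left [simp] = additive_zero[of "\<lambda>\<alpha>. pair \<alpha> _", OF pair_add_left]
lemmas pair_zero_right [simp] = additive_zero[of "pair _", OF pair_add_right]
lemmas pair_sum_left = additive_sum[of "\<lambda>\<alpha>. pair \<alpha> _", OF pair_add_left]
lemmas pair_sum_right = additive_sum[of "pair _", OF pair_add_right]

lemma pair_diff_left: "pair (\<alpha> - \<beta>) \<theta> = pair \<alpha> \<theta> - pair \<beta> \<theta>"
  using pair_add_left[of "\<alpha> - \<beta>" \<beta> \<theta>] by simp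

lemma pair_diff_right: "pair \<alpha> (\<theta> - \<psi>) = pair \<alpha> \<theta> - pair \<alpha> \<psi>"
  using pair_add_right[of \<alpha> "\<theta> - \<psi>" \<psi>] by simp

lemma two_eq_zero [simp]: "(2 :: 'h) = 0"
  using char_two by (simp only: one_add_one)

lemma add_self [simp]: "(x :: 'h) + x = 0"
  by (simp flip: mult_2)

lemma uminus_eq [simp]: "- (x :: 'h) = x"
  using add_self[of x] by (simp add: eq_neg_iff_add_eq_0)

lemma diff_eq_add [simp]: "(x :: 'h) - y = x + y"
  using uminus_eq[of y] by (simp only: diff_conv_add_uminus)

lemma dual_uminus_eq: "- (a :: 'a) = a"
proof -
  have "a + a = (etaL 1 + etaL 1) * a" by (simp add: distrib_right)
  also have "etaL 1 + etaL 1 = etaL (1 + 1)" by (rule etaL_simps(3)[symmetric])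
  also have "\<dots> = 0" by (simp only: char_two etaL_simps)
  finally show ?thesis by (simp add: eq_neg_iff_add_eq_0)
qed

lemma taus_square':
  "taus i * taus i = etaL tau * xi (i + 1) + etaL rho * taus (i + 1)
     + etaL rho * (taus 0 * xi (i + 1))"
proof -
  have "taus i * taus i =
      - (etaL tau * xi (i + 1) + etaL rho * (taus (i + 1) + taus 0 * xi (i + 1)))"
    using taus_square[of i] by (subst eq_neg_iff_add_eq_0) (simp add: power2_eq_square add.assoc)
  then show ?thesis unfolding dual_uminus_eq by (simp add: algebra_simps)
qed

subsection \<open>Milnor monomials and the dual basis\<close>

abbreviation mono where "mono \<equiv> milnor_monomial taus xi"

lemma mono_eq: "finite S \<Longrightarrow> {i. R i \<noteq> 0} \<subseteq> S \<Longrightarrow>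
    mono (E, R) = (\<Prod>i\<in>E. taus i) * (\<Prod>i\<in>S. xi i ^ R i)"
  unfolding milnor_monomial_def prod.case
  by (intro arg_cong2[where f = "(*)"] refl prod.mono_neutral_left) auto

lemma mono_zero: "mono (E, \<lambda>_. 0) = (\<Prod>i\<in>E. taus i)"
  by (simp add: milnor_monomial_def)

lemma xi_mult_mono:
  assumes "(E, R) \<in> milnor_indices"
  shows "xi k * mono (E, R) = mono (E, R(k := Suc (R k)))"
proof -
  define T where "T = {i. R i \<noteq> 0} - {k}"
  have T: "finite T" "k \<notin> T" using assms by (auto simp: milnor_indices_def T_def)
  have "(\<Prod>i\<in>T. xi i ^ (R(k := Suc (R k))) i) = (\<Prod>i\<in>T. xi i ^ R i)"
    using T by (intro prod.cong) auto
  then have "(\<Prod>i\<in>insert k T. xi i ^ (R(k := Suc (R k))) i) = xi k * (\<Prod>i\<in>insert k T. xi i ^ R i)"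
    using T by (simp add: mult.assoc)
  moreover have "mono (E, R) = (\<Prod>i\<in>E. taus i) * (\<Prod>i\<in>insert k T. xi i ^ R i)"
    using T by (intro mono_eq) (auto simp: T_def)
  moreover have "mono (E, R(k := Suc (R k))) =
      (\<Prod>i\<in>E. taus i) * (\<Prod>i\<in>insert k T. xi i ^ (R(k := Suc (R k))) i)"
    using T by (intro mono_eq) (auto simp: T_def)
  ultimately show ?thesis by (simp only: mult.left_commute)
qed

lemma taus_mult_mono:
  "finite E \<Longrightarrow> i \<notin> E \<Longrightarrow> taus i * mono (E, R) = mono (insert i E, R)"
  by (simp add: milnor_monomial_def mult.assoc)

lemma milnor_indices_upd:
  assumes "(E, R) \<in> milnor_indices" "k \<ge> 1"
  shows "(E, R(k := r)) \<in> milnor_indices"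
proof -
  have "{i. (R(k := r)) i \<noteq> 0} \<subseteq> insert k {i. R i \<noteq> 0}" by auto
  then have "finite {i. (R(k := r)) i \<noteq> 0}"
    by (rule finite_subset) (use assms in \<open>auto simp: milnor_indices_def\<close>)
  then show ?thesis using assms by (simp add: milnor_indices_def)
qed

lemma milnor_indices_zero: "finite E \<Longrightarrow> (E, \<lambda>_. 0) \<in> milnor_indices"
  by (simp add: milnor_indices_def)

lemma milnor_indices_xi_power: "finite E \<Longrightarrow> k \<ge> 1 \<Longrightarrow> (E, xi_power k m) \<in> milnor_indices"
  by (auto simp: milnor_indices_def xi_power_def)

lemma left_linear_eqI:
  assumes "\<And>a b. f (a + b) = f a + f b" "\<And>h a. f (etaL h * a) = h * f a"
    and "\<And>a b. g (a + b) = g a + g b" "\<And>h a. g (etaL h * a) = h * (g a :: 'h)"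
    and "\<And>M. M \<in> milnor_indices \<Longrightarrow> f (mono M) = g (mono M)"
  shows "f x = g x"
proof -
  interpret M: module "\<lambda>h a. etaL h * a"
    using monomials_basis by (simp add: free_basis_def)
  have "x \<in> M.span (mono ` milnor_indices)"
    using monomials_basis by (simp add: free_basis_def)
  then show ?thesis
  proof (induction rule: M.span_induct_alt)
    case base
    then show ?case using additive_zero[of f] additive_zero[of g] assms by simp
  next
    case (step c x y)
    then show ?case using assms by auto
  qed
qed

lemma milnor_dual_ext:
  assumes "\<And>M. M \<in> milnor_indices \<Longrightarrow> pair (mono M) \<theta> = pair (mono M) \<psi>"
  shows "\<theta> = \<psi>"
proof -
  interpret M: module "\<lambda>h \<theta>. iota h * \<theta>"
    using hat_basis by (simp add: free_basis_def)
  have "\<theta> - \<psi> \<in> M.span (hat ` milnor_indices)"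
    using hat_basis by (simp add: free_basis_def)
  then obtain t r where t: "finite t" "t \<subseteq> hat ` milnor_indices"
    and eq: "\<theta> - \<psi> = (\<Sum>a\<in>t. iota (r a) * a)"
    unfolding M.span_explicit by blast
  have "r a = 0" if a: "a \<in> t" for a
  proof -
    obtain N where N: "N \<in> milnor_indices" "a = hat N" using t a by blast
    have "0 = pair (mono N) (\<theta> - \<psi>)" using assms[OF N(1)] by (simp only: pair_diff_right) simp
    also have "\<dots> = (\<Sum>b\<in>t. r b * pair (mono N) b)"
      by (simp add: eq pair_sum_right pair_left)
    also have "\<dots> = (\<Sum>b\<in>t. if b = a then r b else 0)"
      using t N by (intro sum.cong refl) (auto simp: hat_dual)
    also have "\<dots> = r a" using t a by simp
    finally show ?thesis by simp
  qed
  then show ?thesis using eq by simp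
qed

lemma dual_pair_ext:
  assumes "\<And>\<theta>. pair x \<theta> = pair y \<theta>"
  shows "x = y"
proof -
  interpret M: module "\<lambda>h a. etaL h * a"
    using monomials_basis by (simp add: free_basis_def)
  have "x - y \<in> M.span (mono ` milnor_indices)"
    using monomials_basis by (simp add: free_basis_def)
  then obtain t r where t: "finite t" "t \<subseteq> mono ` milnor_indices"
    and eq: "x - y = (\<Sum>a\<in>t. etaL (r a) * a)"
    unfolding M.span_explicit by blast
  have "r a = 0" if a: "a \<in> t" for a
  proof -
    obtain N where N: "N \<in> milnor_indices" "a = mono N" using t a by blast
    have "0 = pair (x - y) (hat N)" using assms by (simp only: pair_diff_left) simp
    also have "\<dots> = (\<Sum>b\<in>t. r b * pair b (hat N))"
      by (simp add: eq pair_sum_left pair_etaL)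
    also have "\<dots> = (\<Sum>b\<in>t. if b = a then r b else 0)"
      using t N by (intro sum.cong refl) (auto simp: hat_dual)
    also have "\<dots> = r a" using t a by simp
    finally show ?thesis by simp
  qed
  then show ?thesis using eq by simp
qed

lemma pair_xi_hat:
  assumes "(E, R) \<in> milnor_indices" "k \<ge> 1"
  shows "pair (xi k * y) (hat (E, R)) =
    (if R k = 0 then 0 else pair y (hat (E, R(k := R k - 1))))"
proof (rule left_linear_eqI[where
      g = "\<lambda>y. if R k = 0 then 0 else pair y (hat (E, R(k := R k - 1)))"])
  show "pair (xi k * (a + b)) (hat (E, R)) = pair (xi k * a) (hat (E, R)) + pair (xi k * b) (hat (E, R))"
    for a b by (simp add: distrib_left pair_add_left)
  show "pair (xi k * (etaL h * a)) (hat (E, R)) = h * pair (xi k * a) (hat (E, R))" for h a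
    by (simp add: mult.left_commute[of _ "etaL h"] pair_etaL)
next
  fix M :: "nat set \<times> (nat \<Rightarrow> nat)" assume M: "M \<in> milnor_indices"
  obtain E' R' where [simp]: "M = (E', R')" by fastforce
  have "(E', R'(k := Suc (R' k))) \<in> milnor_indices" "(E, R(k := R k - 1)) \<in> milnor_indices"
    using M assms milnor_indices_upd by auto
  moreover have "R'(k := Suc (R' k)) = R \<longleftrightarrow> R k \<noteq> 0 \<and> R' = R(k := R k - 1)"
    by (auto simp: fun_eq_iff)
  ultimately show "pair (xi k * mono M) (hat (E, R)) =
      (if R k = 0 then 0 else pair (mono M) (hat (E, R(k := R k - 1))))"
    using M assms by (simp add: xi_mult_mono hat_dual)
qed (simp_all add: pair_add_left pair_etaL)

lemma eps_mono:
  assumes "(E, R) \<in> milnor_indices"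
  shows "eps (mono (E, R)) = (if (E, R) = ({}, \<lambda>_. 0) then 1 else 0)"
proof -
  have fin: "finite E" "finite {i. R i \<noteq> 0}" and "R 0 = 0"
    using assms by (auto simp: milnor_indices_def)
  have "eps (xi i ^ R i) = 0" if "R i \<noteq> 0" for i
    using that \<open>R 0 = 0\<close> eps_xi[of i] by (cases i) (auto simp: power_0_left)
  then have "eps (mono (E, R)) = (\<Prod>i\<in>E. 0) * (\<Prod>i | R i \<noteq> 0. 0)"
    by (simp add: milnor_monomial_def eps_taus)
  also have "\<dots> = (if E = {} \<and> {i. R i \<noteq> 0} = {} then 1 else 0)"
    using fin by (simp only: prod_constant) (simp add: power_0_left)
  finally show ?thesis by (simp add: fun_eq_iff)
qed

lemma hat_zero: "hat ({}, \<lambda>_. 0) = 1"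
proof (rule milnor_dual_ext)
  fix M :: "nat set \<times> (nat \<Rightarrow> nat)" assume "M \<in> milnor_indices"
  then show "pair (mono M) (hat ({}, \<lambda>_. 0)) = pair (mono M) 1"
    by (cases M) (simp add: hat_dual milnor_indices_zero pair_one eps_mono)
qed

abbreviation sq where "sq m \<equiv> hat ({}, xi_power 1 m)"

lemma sq_zero: "sq 0 = 1"
  by (simp add: xi_power_0 hat_zero)

lemma pair_xi_P:
  assumes "n \<ge> 1" "k \<ge> 1"
  shows "pair (xi k * y) (milnor_P hat n) = (if k = n then eps y else 0)"
  unfolding milnor_P_def using assms
  by (simp add: pair_xi_hat milnor_indices_xi_power xi_power_apply xi_power_upd xi_power_0
      hat_zero pair_one)

lemma pair_xi1_sq: "pair (xi 1 * y) (sq m) = (if m = 0 then 0 else pair y (sq (m - 1)))"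
  by (simp only: pair_xi_hat milnor_indices_xi_power finite.emptyI le_refl xi_power_apply
      xi_power_upd simp_thms if_True)

lemma pair_xi_sq: "k \<ge> 2 \<Longrightarrow> pair (xi k * y) (sq m) = 0"
  by (simp add: pair_xi_hat milnor_indices_xi_power xi_power_apply)

lemma pair_xi1_power_sq:
  "pair (xi 1 ^ d * y) (sq m) = (if d \<le> m then pair y (sq (m - d)) else 0)"
proof (induction d arbitrary: y)
  case (Suc d)
  have "pair (xi 1 ^ Suc d * y) (sq m) = pair (xi 1 ^ d * (xi 1 * y)) (sq m)"
    by (simp add: mult_ac)
  also have "\<dots> = (if Suc d \<le> m then pair y (sq (m - Suc d)) else 0)"
    by (auto simp: Suc pair_xi1_sq Suc_eq_plus1)
  finally show ?case .
qed simp

lemma pair_taus_mono_sq: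
  assumes "(E, R) \<in> milnor_indices" "i \<ge> 1"
  shows "pair (taus i * mono (E, R)) (sq m) = 0"
  using assms
proof (induction "card E" arbitrary: E i rule: less_induct)
  case less
  have fin: "finite E" using less.prems by (simp add: milnor_indices_def)
  show ?case
  proof (cases "i \<in> E")
    case False
    have "(insert i E, R) \<in> milnor_indices" using less.prems by (simp add: milnor_indices_def)
    then show ?thesis using False fin
      by (simp add: taus_mult_mono hat_dual milnor_indices_xi_power)
  next
    case True
    let ?M = "mono (E - {i}, R)"
    have ind: "(E - {i}, R) \<in> milnor_indices" using less.prems by (simp add: milnor_indices_def)
    have "mono (E, R) = taus i * ?M"
      using taus_mult_mono[of "E - {i}" i R] fin True by (simp add: insert_absorb)
    then have "taus i * mono (E, R) = etaL tau * (xi (i + 1) * ?M)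
        + etaL rho * (taus (i + 1) * ?M) + etaL rho * (xi (i + 1) * (taus 0 * ?M))"
      by (simp only: mult.assoc[symmetric] taus_square') (simp add: algebra_simps)
    moreover have "card (E - {i}) < card E" using fin True by (rule card_Diff1_less)
    ultimately show ?thesis using less.prems ind
      by (simp add: pair_add_left pair_etaL pair_xi_sq less.hyps del: add_2_eq_Suc)
  qed
qed

lemma pair_taus_sq:
  assumes "i \<ge> 1"
  shows "pair (taus i * y) (sq m) = 0"
  by (rule left_linear_eqI[where g = "\<lambda>_. 0"])
     (use assms pair_taus_mono_sq in
       \<open>auto simp: distrib_left pair_add_left mult.left_commute[of _ "etaL _"] pair_etaL\<close>)

lemma pair_taus0_sq: "pair (taus 0) (sq m) = 0"
  using hat_dual[of "({0}, \<lambda>_. 0)" "({}, xi_power 1 m)"]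
  by (simp add: mono_zero milnor_indices_zero milnor_indices_xi_power)

lemma pair_one_sq: "pair 1 (sq m) = (if m = 0 then 1 else 0)"
  using hat_dual[of "({}, \<lambda>_. 0)" "({}, xi_power 1 m)"]
  by (simp add: mono_zero milnor_indices_zero milnor_indices_xi_power zero_eq_xi_power)

subsection \<open>Products and the coproduct\<close>

lemma act_exists:
  "\<exists>L. (\<forall>u v. L (u + v) = L u + L v) \<and> (\<forall>a b. L (tensor a b) = a * etaR (pair b \<theta>))"
  by (rule tensor_lift[of "\<lambda>a b. a * etaR (pair b \<theta>)"])
     (auto simp: distrib_left distrib_right mult.assoc pair_add_left pair_etaL)

text \<open>\<open>act \<theta>\<close> is the map \<open>a \<otimes> b \<mapsto> a \<eta>\<^sub>R(\<langle>b, \<theta>\<rangle>)\<close>, a left inverse of \<open>\<Delta>\<close> for \<open>\<theta> = 1\<close>.\<close>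

definition act :: "'s \<Rightarrow> 't \<Rightarrow> 'a" where
  "act \<theta> = (SOME L. (\<forall>u v. L (u + v) = L u + L v) \<and>
     (\<forall>a b. L (tensor a b) = a * etaR (pair b \<theta>)))"

lemma act_add: "act \<theta> (u + v) = act \<theta> u + act \<theta> v"
  and act_tensor: "act \<theta> (tensor a b) = a * etaR (pair b \<theta>)"
  using someI_ex[OF act_exists[of \<theta>]] unfolding act_def by blast+

lemmas act_0 = additive_zero[of "act _", OF act_add]
lemmas act_sum = additive_sum[of "act _", OF act_add]

lemma pair_product: "pair \<alpha> (\<theta>\<^sub>1 * \<theta>\<^sub>2) = pair (act \<theta>\<^sub>2 (Delta \<alpha>)) \<theta>\<^sub>1"
proof -
  obtain ps where ps: "Delta \<alpha> = (\<Sum>(a, b)\<leftarrow>ps. tensor a b)"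
    using tensor_generate by blast
  have "act \<theta>\<^sub>2 (Delta \<alpha>) = (\<Sum>(a, b)\<leftarrow>ps. a * etaR (pair b \<theta>\<^sub>2))"
    by (simp add: ps additive_sum_list[of "act _", OF act_add] case_prod_unfold comp_def act_tensor)
  then have "pair (act \<theta>\<^sub>2 (Delta \<alpha>)) \<theta>\<^sub>1 = (\<Sum>(a, b)\<leftarrow>ps. pair (a * etaR (pair b \<theta>\<^sub>2)) \<theta>\<^sub>1)"
    by (simp add: additive_sum_list[of "\<lambda>\<alpha>. pair \<alpha> _", OF pair_add_left] case_prod_unfold comp_def)
  then show ?thesis by (simp add: pair_mult[OF ps] pair_right)
qed

lemma act_left: "act \<theta> (tensor a 1 * z) = a * act \<theta> z"
  by (rule tensor_induct[of _ z])
     (simp_all add: tensor_mult act_tensor act_0 act_add distrib_left mult.assoc)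

lemma act_right:
  assumes "\<And>y. pair (b * y) \<theta> = pair y \<theta>'"
  shows "act \<theta> (tensor 1 b * z) = act \<theta>' z"
  by (rule tensor_induct[of _ z])
     (simp_all add: tensor_mult act_tensor act_0 act_add distrib_left assms)

lemma act_zero: "act 0 z = 0"
  by (rule tensor_induct[of _ z]) (simp_all add: act_tensor act_0 act_add)

lemma act_right_0: "(\<And>y. pair (b * y) \<theta> = 0) \<Longrightarrow> act \<theta> (tensor 1 b * z) = 0"
  using act_right[of b \<theta> 0 z] by (simp add: act_zero)

lemma act_one: "act 1 (Delta \<alpha>) = \<alpha>"
  by (rule dual_pair_ext) (simp flip: pair_product)

lemma eps_act: "eps (act \<theta> (Delta \<alpha>)) = pair \<alpha> \<theta>"
  by (simp flip: pair_one pair_product)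

lemma act_split: "act \<theta> (tensor a b * z) = a * act \<theta> (tensor 1 b * z)"
proof -
  have "tensor a b * z = tensor a 1 * (tensor 1 b * z)"
    by (simp add: tensor_mult flip: mult.assoc)
  then show ?thesis by (simp only: act_left)
qed

lemma act_Delta_xi:
  "act \<theta> (Delta (xi k) * z) = (\<Sum>i\<le>k. xi (k - i) ^ 2 ^ i * act \<theta> (tensor 1 (xi i) * z))"
  by (simp add: Delta_xi sum_distrib_right act_sum act_split[of _ "_ ^ _"])

lemma act_Delta_taus:
  "act \<theta> (Delta (taus k) * z) =
    taus k * act \<theta> z + (\<Sum>i\<le>k. xi (k - i) ^ 2 ^ i * act \<theta> (tensor 1 (taus i) * z))"
  by (simp add: Delta_taus sum_distrib_right distrib_right act_add act_sum act_left
      act_split[of _ "_ ^ _"])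

lemma tensor_prod: "(\<Prod>i\<in>A. tensor (f i) (g i)) = tensor (\<Prod>i\<in>A. f i) (\<Prod>i\<in>A. g i)"
  by (induction A rule: infinite_finite_induct) (simp_all add: tensor_one tensor_mult)

lemma tensor_power: "tensor a b ^ k = tensor (a ^ k) (b ^ k)"
  by (induction k) (simp_all add: tensor_one tensor_mult)

subsection \<open>Left multiplication by \<open>Q\<^sub>i\<close>\<close>

lemma pair_xi_Q: "k \<ge> 1 \<Longrightarrow> pair (xi k * y) (milnor_Q hat i) = 0"
  by (simp add: milnor_Q_def pair_xi_hat milnor_indices_zero)

lemma pair_xi_power_Q: "k \<ge> 1 \<Longrightarrow> pair (xi k ^ 2 ^ r * y) (milnor_Q hat i) = 0"
  by (subst power_eq_if) (simp add: pair_xi_Q mult.assoc)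

lemma milnor_Q_mult_hat:
  assumes ER: "(E, R) \<in> milnor_indices"
  shows "milnor_Q hat i * hat (E, R) = (if i \<in> E then 0 else hat (insert i E, R))"
proof (rule milnor_dual_ext)
  fix M :: "nat set \<times> (nat \<Rightarrow> nat)" assume M: "M \<in> milnor_indices"
  obtain E' R' where M_eq: "M = (E', R')" by fastforce
  have fin: "finite E'" using M by (simp add: M_eq milnor_indices_def)
  define L where "L z = pair (act (hat (E, R)) z) (milnor_Q hat i)" for z
  have L_add: "L (u + v) = L u + L v" for u v
    by (simp add: L_def act_add pair_add_left)
  have xi: "mult_equiv L (Delta (xi k)) (tensor 1 (xi k))" for k
  proof (unfold mult_equiv_def, rule allI)
    fix z
    have "L (Delta (xi k) * z) =
        (\<Sum>j\<le>k. pair (xi (k - j) ^ 2 ^ j * act (hat (E, R)) (tensor 1 (xi j) * z)) (milnor_Q hat i))"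
      by (simp add: L_def act_Delta_xi pair_sum_left)
    also have "\<dots> = (\<Sum>j\<le>k. if j = k then L (tensor 1 (xi k) * z) else 0)"
      by (intro sum.cong refl) (auto simp: pair_xi_power_Q L_def xi_zero)
    finally show "L (Delta (xi k) * z) = L (tensor 1 (xi k) * z)" by simp
  qed
  have taus: "mult_equiv L (Delta (taus k)) (tensor (taus k) 1 + tensor 1 (taus k))" for k
  proof (unfold mult_equiv_def, rule allI)
    fix z
    have "L (Delta (taus k) * z) = L (tensor (taus k) 1 * z) +
        (\<Sum>j\<le>k. pair (xi (k - j) ^ 2 ^ j * act (hat (E, R)) (tensor 1 (taus j) * z)) (milnor_Q hat i))"
      by (simp add: L_def act_Delta_taus act_left pair_sum_left pair_add_left)
    also have "(\<Sum>j\<le>k. pair (xi (k - j) ^ 2 ^ j * act (hat (E, R)) (tensor 1 (taus j) * z))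
        (milnor_Q hat i)) = (\<Sum>j\<le>k. if j = k then L (tensor 1 (taus k) * z) else 0)"
      by (intro sum.cong refl) (auto simp: pair_xi_power_Q L_def xi_zero)
    finally show "L (Delta (taus k) * z) = L ((tensor (taus k) 1 + tensor 1 (taus k)) * z)"
      by (simp add: distrib_right L_add)
  qed
  have "pair (mono M) (milnor_Q hat i * hat (E, R)) = L (Delta (mono (E', R')))"
    by (simp add: pair_product L_def M_eq)
  also have "\<dots> = L ((\<Prod>k\<in>E'. Delta (taus k)) * (\<Prod>k | R' k \<noteq> 0. Delta (xi k) ^ R' k))"
    by (simp add: milnor_monomial_def Delta_simps)
  also have "\<dots> = L ((\<Prod>k\<in>E'. tensor (taus k) 1 + tensor 1 (taus k)) *
      (\<Prod>k | R' k \<noteq> 0. tensor 1 (xi k) ^ R' k))"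
    by (intro mult_equivD mult_equiv_mult mult_equiv_prod mult_equiv_power xi taus)
  also have "\<dots> = (\<Sum>F\<in>Pow E'. L (tensor (\<Prod>k\<in>F. taus k) (mono (E' - F, R'))))"
    using fin
    by (simp add: prod_add tensor_power tensor_prod sum_distrib_right tensor_mult
        milnor_monomial_def additive_sum[of L, OF L_add])
  also have "\<dots> = (\<Sum>F\<in>Pow E'. if F = {i} then (if E' - {i} = E \<and> R' = R then 1 else 0) else 0)"
  proof (intro sum.cong refl)
    fix F assume F: "F \<in> Pow E'"
    have "(E' - F, R') \<in> milnor_indices" "finite F"
      using M F finite_subset[of F E'] by (auto simp: M_eq milnor_indices_def)
    then have "L (tensor (\<Prod>k\<in>F. taus k) (mono (E' - F, R'))) =
        pair (mono (F, \<lambda>_. 0)) (hat ({i}, \<lambda>_. 0)) * (if E' - F = E \<and> R' = R then 1 else 0)"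
      using ER by (simp add: L_def act_tensor hat_dual milnor_Q_def mono_zero)
    also have "\<dots> = (if F = {i} then (if E' - {i} = E \<and> R' = R then 1 else 0) else 0)"
      using \<open>finite F\<close> by (auto simp: hat_dual milnor_indices_zero)
    finally show "L (tensor (\<Prod>k\<in>F. taus k) (mono (E' - F, R'))) =
        (if F = {i} then (if E' - {i} = E \<and> R' = R then 1 else 0) else 0)" .
  qed
  also have "\<dots> = (if i \<in> E' \<and> E' - {i} = E \<and> R' = R then 1 else 0)"
    using fin by simp
  also have "\<dots> = pair (mono M) (if i \<in> E then 0 else hat (insert i E, R))"
  proof (cases "i \<in> E")
    case False
    have "(insert i E, R) \<in> milnor_indices" using ER by (simp add: milnor_indices_def)
    moreover have "i \<in> E' \<and> E' - {i} = E \<longleftrightarrow> E' = insert i E" using False by auto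
    ultimately show ?thesis using False M by (auto simp: hat_dual M_eq)
  qed auto
  finally show "pair (mono M) (milnor_Q hat i * hat (E, R)) =
      pair (mono M) (if i \<in> E then 0 else hat (insert i E, R))" .
qed

lemma milnor_Q_list_mult_hat:
  assumes "(E, R) \<in> milnor_indices"
  shows "prod_list (map (milnor_Q hat) [a..<b]) * hat (E, R) =
    (if {a..<b} \<inter> E = {} then hat ({a..<b} \<union> E, R) else 0)"
  using assms
proof (induction b arbitrary: E)
  case (Suc b)
  show ?case
  proof (cases "a \<le> b")
    case True
    then have *: "[a..<Suc b] = [a..<b] @ [b]" "{a..<Suc b} = insert b {a..<b}" by auto
    have "(insert b E, R) \<in> milnor_indices" using Suc.prems by (simp add: milnor_indices_def)
    with Suc show ?thesis unfolding * by (auto simp: milnor_Q_mult_hat mult.assoc)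
  qed simp
qed simp

subsection \<open>The commutator on multiples of \<open>\<xi>\<^sub>k\<close>\<close>

lemma sum_atMost_eq: "(\<Sum>i\<le>k. f i) = f 0 + (\<Sum>i=1..k. f i)" for f :: "nat \<Rightarrow> 'h"
  by (simp add: atMost_atLeast0 sum.atLeast_Suc_atMost One_nat_def)

lemma pair_xi_sq_P:
  assumes "n \<ge> 1" "k \<ge> 1"
  shows "pair (xi k * \<alpha>) (sq m * milnor_P hat n) =
    (if k = 1 \<and> m > 0 then pair \<alpha> (sq (m - 1) * milnor_P hat n) else 0)
    + (if n \<le> k then pair (xi (k - n) ^ 2 ^ n * \<alpha>) (sq m) else 0)"
proof -
  let ?P = "milnor_P hat n"
  let ?f = "\<lambda>i. pair (xi (k - i) ^ 2 ^ i * act ?P (tensor 1 (xi i) * Delta \<alpha>)) (sq m)"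
  have "act ?P (tensor 1 (xi i) * Delta \<alpha>) = (if i = n then \<alpha> else 0)" if "i \<ge> 1" for i
    using act_right[of "xi i" ?P 1] act_right_0[of "xi i" ?P] that assms
    by (cases "i = n") (simp_all add: pair_xi_P pair_one act_one)
  then have "(\<Sum>i=1..k. ?f i) =
      (\<Sum>i=1..k. if i = n then pair (xi (k - n) ^ 2 ^ n * \<alpha>) (sq m) else 0)"
    by (intro sum.cong refl) auto
  moreover have "?f 0 = (if k = 1 \<and> m > 0 then pair \<alpha> (sq (m - 1) * ?P) else 0)"
    using assms by (cases "k = 1")
      (simp_all add: xi_zero tensor_one pair_xi1_sq pair_xi_sq pair_product)
  ultimately show ?thesis
    using assms by (simp add: pair_product Delta_simps act_Delta_xi pair_sum_left sum_atMost_eq)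
qed

lemma pair_xi_P_sq:
  assumes "n \<ge> 1" "k \<ge> 1"
  shows "pair (xi k * \<alpha>) (milnor_P hat n * sq m) =
    (if k = n then pair \<alpha> (sq m) else 0)
    + (if k = 1 \<and> m > 0 then pair \<alpha> (milnor_P hat n * sq (m - 1)) else 0)"
proof -
  let ?P = "milnor_P hat n"
  let ?f = "\<lambda>i. pair (xi (k - i) ^ 2 ^ i * act (sq m) (tensor 1 (xi i) * Delta \<alpha>)) ?P"
  have "?f 1 = (if k = 1 \<and> m > 0 then pair \<alpha> (?P * sq (m - 1)) else 0)"
  proof (cases "k = 1")
    case True
    have "act (sq m) (tensor 1 (xi 1) * Delta \<alpha>) = (if m = 0 then 0 else act (sq (m - 1)) (Delta \<alpha>))"
      using act_right[of "xi 1" "sq m" "sq (m - 1)"] act_right_0[of "xi 1" "sq m"]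
      by (cases "m = 0") (simp_all add: pair_xi1_sq)
    with True show ?thesis by (simp add: xi_zero pair_product)
  next
    case False
    with assms show ?thesis by (simp add: power2_eq_square mult.assoc pair_xi_P eps_xi)
  qed
  moreover have "act (sq m) (tensor 1 (xi i) * Delta \<alpha>) = 0" if "i \<ge> 2" for i
    using that by (intro act_right_0 pair_xi_sq)
  then have "(\<Sum>i=1..k. ?f i) = (\<Sum>i=1..k. if i = 1 then ?f 1 else 0)"
    by (intro sum.cong refl) auto
  moreover have "?f 0 = (if k = n then pair \<alpha> (sq m) else 0)"
    using assms by (simp add: xi_zero tensor_one pair_xi_P eps_act)
  ultimately show ?thesis
    using assms by (simp add: pair_product Delta_simps act_Delta_xi pair_sum_left sum_atMost_eq)
qed

lemma pair_commutator:
  "pair \<alpha> (commutator \<theta> \<psi>) = pair \<alpha> (\<theta> * \<psi>) + pair \<alpha> (\<psi> * \<theta>)"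
  by (simp add: commutator_def pair_diff_right)

lemma pair_xi1_commutator:
  assumes "n \<ge> 1"
  shows "pair (xi 1 * \<alpha>) (commutator (milnor_P hat n) (sq m)) =
    (if m = 0 then 0 else pair \<alpha> (commutator (milnor_P hat n) (sq (m - 1))))"
  using assms by (auto simp: pair_commutator pair_xi_sq_P pair_xi_P_sq xi_zero add_ac)

lemma pair_xi1_power_commutator:
  assumes "n \<ge> 1"
  shows "pair (xi 1 ^ r * \<alpha>) (commutator (milnor_P hat n) (sq m)) =
    (if r \<le> m then pair \<alpha> (commutator (milnor_P hat n) (sq (m - r))) else 0)"
proof (induction r arbitrary: \<alpha>)
  case (Suc r)
  have "pair (xi 1 ^ Suc r * \<alpha>) (commutator (milnor_P hat n) (sq m)) =
      pair (xi 1 ^ r * (xi 1 * \<alpha>)) (commutator (milnor_P hat n) (sq m))"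
    by (simp add: mult_ac)
  also have "\<dots> = (if Suc r \<le> m
      then pair \<alpha> (commutator (milnor_P hat n) (sq (m - Suc r))) else 0)"
    using assms by (auto simp: Suc pair_xi1_commutator Suc_eq_plus1)
  finally show ?case .
qed simp

lemma pair_xi_commutator:
  assumes "n \<ge> 1" "k \<ge> 2"
  shows "pair (xi k * \<alpha>) (commutator (milnor_P hat n) (sq (2 ^ n))) =
    (if k = n + 1 then eps \<alpha> else 0)"
proof -
  have "pair (xi k * \<alpha>) (commutator (milnor_P hat n) (sq (2 ^ n))) =
      (if n < k then pair (xi (k - n) ^ 2 ^ n * \<alpha>) (sq (2 ^ n)) else 0)"
    using assms by (auto simp: pair_commutator pair_xi_sq_P pair_xi_P_sq xi_zero)
  also have "\<dots> = (if k = n + 1 then eps \<alpha> else 0)"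
  proof (cases "k > n + 1")
    case True
    then show ?thesis by (subst power_eq_if) (simp add: mult.assoc pair_xi_sq)
  next
    case False
    then show ?thesis by (auto simp: pair_xi1_power_sq sq_zero pair_one)
  qed
  finally show ?thesis .
qed

subsection \<open>The commutator on products of the \<open>\<tau>\<^sub>i\<close>\<close>

abbreviation tau_prod where "tau_prod E \<equiv> (\<Prod>i\<in>E. taus i)"

lemma pair_tau_prod_P: "finite E \<Longrightarrow> n \<ge> 1 \<Longrightarrow> pair (tau_prod E) (milnor_P hat n) = 0"
  using hat_dual[of "(E, \<lambda>_. 0)" "({}, xi_power n 1)"]
  by (simp add: mono_zero milnor_P_def milnor_indices_zero milnor_indices_xi_power zero_eq_xi_power)

lemma eps_tau_prod: "finite E \<Longrightarrow> eps (tau_prod E) = (if E = {} then 1 else 0)"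
  by (simp add: eps_taus power_0_left)

lemma pair_taus0_square_sq: "pair (taus 0 * taus 0) (sq m) = (if m = 1 then tau else 0)"
proof -
  have "pair (taus 0 * taus 0) (sq m) = tau * pair (xi 1 * 1) (sq m)
      + rho * pair (taus 1 * 1) (sq m) + rho * pair (xi 1 * taus 0) (sq m)"
    by (simp add: taus_square' pair_add_left pair_etaL mult.commute[of "taus 0"])
  then show ?thesis
    by (auto simp: pair_xi1_sq pair_taus_sq pair_taus0_sq pair_one_sq simp del: mult_1_right)
qed

lemma pair_tau_prod_P_sq:
  assumes n: "n \<ge> 1" and fin: "finite E"
  shows "pair (tau_prod E) (milnor_P hat n * sq m) = (if E = {0, n} \<and> m = 1 then tau else 0)"
proof -
  let ?P = "milnor_P hat n"
  define L where "L z = pair (act (sq m) z) ?P" for z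
  have L_add: "L (u + v) = L u + L v" for u v
    by (simp add: L_def act_add pair_add_left)
  have taus: "mult_equiv L (Delta (taus k)) (tensor (xi k) (taus 0) + tensor (taus k) 1)" for k
  proof (unfold mult_equiv_def, rule allI)
    fix z
    have "act (sq m) (tensor 1 (taus i) * z) = 0" if "i \<ge> 1" for i
      using that by (intro act_right_0 pair_taus_sq)
    then have "(\<Sum>i\<le>k. xi (k - i) ^ 2 ^ i * act (sq m) (tensor 1 (taus i) * z)) =
        (\<Sum>i\<le>k. if i = 0 then xi k * act (sq m) (tensor 1 (taus 0) * z) else 0)"
      by (intro sum.cong refl) auto
    then show "L (Delta (taus k) * z) = L ((tensor (xi k) (taus 0) + tensor (taus k) 1) * z)"
      by (simp add: L_def act_Delta_taus distrib_right act_add act_left act_split[of _ "xi k"] add_ac)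
  qed
  \<comment> \<open>As \<open>\<P>\<^sup>n\<close> vanishes on products of two \<open>\<xi>\<close>s, at most one \<open>\<xi>\<^sub>k\<close> with \<open>k \<ge> 1\<close> may occur.\<close>
  have summand: "L (tensor ((\<Prod>k\<in>F. xi k) * tau_prod (E - F)) (taus 0 ^ card F)) =
      (if F = {0, n} then (if E = {0, n} \<and> m = 1 then tau else 0) else 0)"
    (is "?l = ?r") if F: "F \<subseteq> E" for F
  proof (cases "F \<subseteq> {0}")
    case True
    then consider "F = {}" | "F = {0}" by blast
    then show ?thesis
    proof cases
      case 1
      then show ?thesis using fin n
        by (auto simp: L_def act_tensor pair_one_sq pair_tau_prod_P)
    next
      case 2
      then show ?thesis using n by (simp add: L_def act_tensor pair_taus0_sq)
    qed
  next
    case False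
    then obtain e where e: "e \<in> F" "e \<ge> 1" by (force simp: One_nat_def)
    have finF: "finite F" using F fin finite_subset by blast
    define h where "h = pair (taus 0 ^ card F) (sq m)"
    have "?l = pair (xi e * ((\<Prod>k\<in>F - {e}. xi k) * tau_prod (E - F) * etaR h)) ?P"
      using e finF by (simp add: L_def act_tensor h_def prod.remove[of F e] mult.assoc)
    also have "\<dots> = (if e = n then (\<Prod>k\<in>F - {e}. eps (xi k)) * eps (tau_prod (E - F)) * h else 0)"
      using n e by (simp add: pair_xi_P eps_etaR)
    also have "(\<Prod>k\<in>F - {e}. eps (xi k)) = (if F - {e} \<subseteq> {0} then 1 else 0)"
    proof (cases "F - {e} \<subseteq> {0}")
      case True
      then have "eps (xi k) = 1" if "k \<in> F - {e}" for k using that xi_zero by auto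
      with True show ?thesis by simp
    next
      case False
      then obtain k where "k \<in> F - {e}" "k \<ge> 1" by (force simp: One_nat_def)
      with False finF show ?thesis by (auto intro!: prod_zero bexI[of _ k] simp: eps_xi)
    qed
    also have "(if e = n then (if F - {e} \<subseteq> {0} then 1 else 0) * eps (tau_prod (E - F)) * h else 0) = ?r"
    proof (cases "e = n \<and> F - {e} \<subseteq> {0} \<and> E - F = {}")
      case True
      then have EF: "E = F" "e = n" using F by auto
      have "F = {n} \<or> F = {0, n}" using True e by blast
      then show ?thesis
      proof
        assume "F = {n}"
        then show ?thesis using n EF by (simp add: h_def pair_taus0_sq)
      next
        assume F0: "F = {0, n}"
        then have "card F = 2" using n by simp
        then have "h = (if m = 1 then tau else 0)"
          by (simp add: h_def power2_eq_square pair_taus0_square_sq)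
        then show ?thesis using F0 EF by auto
      qed
    next
      case False
      have "\<not> (F = {0, n} \<and> E = {0, n})"
      proof
        assume FE: "F = {0, n} \<and> E = {0, n}"
        then have "e = n" using e by auto
        with FE False show False by auto
      qed
      moreover have "eps (tau_prod (E - F)) = (if E - F = {} then 1 else 0)"
        using fin by (intro eps_tau_prod) simp
      ultimately show ?thesis using False by (cases "e = n"; cases "F - {e} \<subseteq> {0}"; cases "E - F = {}") (simp_all del: eps_simps(6))
    qed
    finally show ?thesis .
  qed
  have "pair (tau_prod E) (?P * sq m) = L (\<Prod>k\<in>E. Delta (taus k))"
    by (simp add: pair_product L_def Delta_simps)
  also have "\<dots> = L (\<Prod>k\<in>E. tensor (xi k) (taus 0) + tensor (taus k) 1)"
    by (intro mult_equivD mult_equiv_prod taus)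
  also have "\<dots> = (\<Sum>F\<in>Pow E. L (tensor ((\<Prod>k\<in>F. xi k) * tau_prod (E - F)) (taus 0 ^ card F)))"
    using fin by (simp add: prod_add tensor_prod tensor_mult additive_sum[of L, OF L_add])
  also have "\<dots> = (\<Sum>F\<in>Pow E. if F = {0, n} then (if E = {0, n} \<and> m = 1 then tau else 0) else 0)"
    by (intro sum.cong refl summand) simp
  also have "\<dots> = (if E = {0, n} \<and> m = 1 then tau else 0)"
    using fin by (simp only: sum.delta finite_Pow_iff) auto
  finally show ?thesis .
qed

definition carry_value :: "nat \<Rightarrow> nat set \<Rightarrow> nat set \<Rightarrow> 'h" where
  "carry_value n G F = (\<Sum>j<n. if G = {j} \<and> F = {j..<n} then tau * rho ^ (n - 1 - j) else 0)"

lemma carry_value_singleton: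
  "carry_value n {j} F = (if j < n \<and> F = {j..<n} then tau * rho ^ (n - 1 - j) else 0)"
proof -
  have "carry_value n {j} F =
      (\<Sum>i<n. if i = j then (if F = {j..<n} then tau * rho ^ (n - 1 - j) else 0) else 0)"
    unfolding carry_value_def by (intro sum.cong refl) auto
  then show ?thesis by auto
qed

lemma carry_value_disjoint: "G \<inter> F = {} \<Longrightarrow> carry_value n G F = 0"
  unfolding carry_value_def by (intro sum.neutral) auto

lemma carry_value_insert:
  assumes "i \<notin> G" "i \<notin> F" "Suc i \<notin> G"
  shows "carry_value n (insert i G) (insert i F) =
    (if Suc i = n \<and> G = {} \<and> F = {} then tau else 0) + rho * carry_value n (insert (Suc i) G) F"
proof (cases "G = {}")
  case True
  have "insert i F = {i..<n} \<longleftrightarrow> F = {Suc i..<n}" if "i < n"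
  proof -
    have "{i..<n} = insert i {Suc i..<n}" using that by auto
    then show ?thesis using insert_ident[of i F "{Suc i..<n}"] assms by simp
  qed
  moreover have "rho * (tau * rho ^ (n - 1 - Suc i)) = tau * rho ^ (n - 1 - i)" if "Suc i < n"
  proof -
    have "n - 1 - i = Suc (n - 1 - Suc i)" using that by simp
    then show ?thesis by (simp only: power_Suc mult.left_commute)
  qed
  ultimately show ?thesis using True
    by (cases "Suc i < n"; cases "Suc i = n") (auto simp: carry_value_singleton One_nat_def)
next
  case False
  then have "insert i G \<noteq> {j}" "insert (Suc i) G \<noteq> {j}" for j using assms by auto
  then have "carry_value n (insert i G) A = 0" "carry_value n (insert (Suc i) G) A = 0" for A
    unfolding carry_value_def by (simp_all only: simp_thms if_False sum.neutral_const)
  then show ?thesis using False by simp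
qed

text \<open>
  A repeated factor is a carry: modulo the terms on which \<open>\<P>\<^sup>n\<close> vanishes, \<open>\<tau>\<^sub>i\<^sup>2\<close> is
  \<open>\<rho>\<tau>\<^sub>i\<^sub>+\<^sub>1\<close>, except that it is \<open>\<tau>\<xi>\<^sub>n\<close> if \<open>i + 1 = n\<close> and no other factor is left.
\<close>

lemma pair_tau_prod_mult_P:
  assumes n: "n \<ge> 1" and "finite G" "finite F" "G \<inter> Suc ` F = {}"
  shows "pair (tau_prod G * tau_prod F) (milnor_P hat n) = carry_value n G F"
  using assms(2-4)
proof (induction "card F" arbitrary: G F rule: less_induct)
  case less
  let ?P = "milnor_P hat n"
  show ?case
  proof (cases "G \<inter> F = {}")
    case True
    then have "tau_prod G * tau_prod F = tau_prod (G \<union> F)"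
      using less.prems by (simp add: prod.union_disjoint)
    then show ?thesis using True less.prems n by (simp add: pair_tau_prod_P carry_value_disjoint)
  next
    case False
    then obtain i where i: "i \<in> G" "i \<in> F" by blast
    define G' F' where "G' = G - {i}" and "F' = F - {i}"
    have GF: "G = insert i G'" "F = insert i F'" "i \<notin> G'" "i \<notin> F'"
      and fin: "finite G'" "finite F'"
      using i less.prems by (auto simp: G'_def F'_def)
    have Suc_i: "Suc i \<notin> G'" using less.prems(3) i by (auto simp: G'_def)
    let ?w = "tau_prod G' * tau_prod F'"
    have "tau_prod G * tau_prod F = taus i * taus i * ?w"
      using GF fin by (simp add: mult_ac)
    also have "\<dots> = etaL tau * (xi (Suc i) * ?w) + etaL rho * (taus (Suc i) * ?w)
        + etaL rho * (xi (Suc i) * (taus 0 * ?w))"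
      by (simp only: taus_square' Suc_eq_plus1[symmetric]) (simp add: algebra_simps)
    also have "taus (Suc i) * ?w = tau_prod (insert (Suc i) G') * tau_prod F'"
      using fin Suc_i by (simp add: mult.assoc)
    finally have "pair (tau_prod G * tau_prod F) ?P =
        (if Suc i = n then tau * eps ?w else 0)
        + rho * pair (tau_prod (insert (Suc i) G') * tau_prod F') ?P"
      using n by (simp add: pair_add_left pair_etaL pair_xi_P eps_taus del: eps_simps(6) prod.insert)
    also have "pair (tau_prod (insert (Suc i) G') * tau_prod F') ?P =
        carry_value n (insert (Suc i) G') F'"
    proof (rule less.hyps)
      show "card F' < card F" using GF fin by simp
      show "insert (Suc i) G' \<inter> Suc ` F' = {}" using less.prems(3) GF by auto
    qed (use fin in auto)
    also have "(if Suc i = n then tau * eps ?w else 0) =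
        (if Suc i = n \<and> G' = {} \<and> F' = {} then tau else 0)"
      using fin by (simp add: eps_tau_prod del: eps_simps(6))
    finally show ?thesis
      using GF Suc_i by (simp add: carry_value_insert)
  qed
qed

lemma sum_powers_interval: "j \<le> n \<Longrightarrow> (\<Sum>e\<in>{Suc j..n}. 2 ^ (e - 1)) = (2::nat) ^ n - 2 ^ j"
proof (induction n rule: dec_induct)
  case (step n)
  have "(2::nat) ^ j \<le> 2 ^ n" using step by (intro power_increasing) auto
  then show ?case using step by simp
qed simp

lemma pair_carry_sq:
  "pair (xi 1 ^ d * etaR (tau * rho ^ k)) (sq m) = (if m = d then tau * rho ^ k else 0)"
  "pair (taus 0 * xi 1 ^ d * etaR (tau * rho ^ k)) (sq m) =
    (if m = d + 1 then tau * rho ^ (k + 1) else 0)"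
proof -
  have etaR: "etaR (tau * rho ^ k) = etaL (tau * rho ^ k) + etaL (rho ^ (k + 1)) * taus 0"
    by (simp add: etaR_tau etaR_one_one[OF rho_mem] distrib_left distrib_right power_add mult_ac)
  have "xi 1 ^ d * etaR (tau * rho ^ k) =
      etaL (tau * rho ^ k) * (xi 1 ^ d * 1) + etaL (rho ^ (k + 1)) * (xi 1 ^ d * taus 0)"
    by (simp only: etaR distrib_left mult_1_left mult_1_right mult_ac)
  then show "pair (xi 1 ^ d * etaR (tau * rho ^ k)) (sq m) = (if m = d then tau * rho ^ k else 0)"
    by (simp only: pair_add_left pair_etaL pair_xi1_power_sq pair_one_sq pair_taus0_sq) auto
  have "taus 0 * xi 1 ^ d * etaR (tau * rho ^ k) =
      etaL (tau * rho ^ k) * (xi 1 ^ d * taus 0)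
      + etaL (rho ^ (k + 1)) * (xi 1 ^ d * (taus 0 * taus 0))"
    by (simp only: etaR distrib_left mult_1_left mult_1_right mult_ac)
  then show "pair (taus 0 * xi 1 ^ d * etaR (tau * rho ^ k)) (sq m) =
      (if m = d + 1 then tau * rho ^ (k + 1) else 0)"
    by (simp only: pair_add_left pair_etaL pair_xi1_power_sq pair_taus0_square_sq pair_taus0_sq)
       (auto simp: mult.commute)
qed

lemma pair_tau_prod_sq_P:
  assumes n: "n \<ge> 1" and fin: "finite E"
  shows "pair (tau_prod E) (sq m * milnor_P hat n) =
    (\<Sum>j<n. (if E = {j..n} \<and> m = 2 ^ n - 2 ^ j then tau * rho ^ (n - 1 - j) else 0)
      + (if j \<ge> 1 \<and> E = insert 0 {j..n} \<and> m = 2 ^ n - 2 ^ j + 1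
         then tau * rho ^ (n - 1 - j + 1) else 0))"
proof -
  let ?P = "milnor_P hat n"
  define L where "L z = pair (act ?P z) (sq m)" for z
  have L_add: "L (u + v) = L u + L v" for u v
    by (simp add: L_def act_add pair_add_left)
  define u where
    "u e = (if e = 0 then tensor (taus 0) 1 else tensor (xi 1 ^ 2 ^ (e - 1)) (taus (e - 1)))" for e
  have taus: "mult_equiv L (Delta (taus e)) (u e + tensor 1 (taus e))" for e
  proof (unfold mult_equiv_def, rule allI)
    fix z
    let ?f = "\<lambda>i. pair (xi (e - i) ^ 2 ^ i * act ?P (tensor 1 (taus i) * z)) (sq m)"
    have "L (Delta (taus e) * z) = pair (taus e * act ?P z) (sq m) + (\<Sum>i\<le>e. ?f i)"
      by (simp add: L_def act_Delta_taus pair_add_left pair_sum_left)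
    also have "\<dots> = L (u e * z) + L (tensor 1 (taus e) * z)"
    proof (cases e)
      case 0
      then show ?thesis by (simp add: L_def u_def act_left xi_zero)
    next
      case (Suc d)
      have "?f i = 0" if "i < d" for i
        using that Suc by (subst power_eq_if) (simp add: mult.assoc pair_xi_sq)
      then have "(\<Sum>i\<le>e. ?f i) = ?f d + ?f e"
        by (simp add: Suc flip: lessThan_Suc_atMost)
      moreover have "pair (taus e * act ?P z) (sq m) = 0"
        by (rule pair_taus_sq) (simp add: Suc)
      ultimately show ?thesis
        using Suc by (simp add: L_def u_def act_split[of _ "_ ^ _"] xi_zero One_nat_def)
    qed
    finally show "L (Delta (taus e) * z) = L ((u e + tensor 1 (taus e)) * z)"
      by (simp add: distrib_right L_add)
  qed
  define V where "V j F = (if 0 \<in> F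
      then (if m = 2 ^ n - 2 ^ j + 1 then tau * rho ^ (n - 1 - j + 1) else 0)
      else (if m = 2 ^ n - 2 ^ j then tau * rho ^ (n - 1 - j) else 0))" for j and F :: "nat set"
  have L_term: "L ((\<Prod>e\<in>F. u e) * (\<Prod>e\<in>E - F. tensor 1 (taus e))) =
      (\<Sum>j<n. if E - F = {j} \<and> F - {0} = {Suc j..n} then V j F else 0)"
    if F: "F \<in> Pow E" for F
  proof -
    have finF: "finite F" using F fin finite_subset by auto
    define F0 where "F0 = F - {0}"
    define F1 where "F1 = (\<lambda>e. e - 1) ` F0"
    define a where "a = (if 0 \<in> F then taus 0 else 1)"
    have inj: "inj_on (\<lambda>e. e - 1) F0" by (auto simp: F0_def inj_on_def)
    have Suc_F1: "Suc ` F1 = F0" by (force simp: F0_def F1_def image_image)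
    have F0: "finite F0" "finite F1" using finF by (auto simp: F0_def F1_def)
    have "(\<Prod>e\<in>F0. u e) = (\<Prod>e\<in>F0. tensor (xi 1 ^ 2 ^ (e - 1)) (taus (e - 1)))"
      by (intro prod.cong refl) (auto simp: u_def F0_def)
    also have "\<dots> = tensor (xi 1 ^ (\<Sum>e\<in>F0. 2 ^ (e - 1))) (tau_prod F1)"
      by (simp add: tensor_prod power_sum F1_def prod.reindex[OF inj])
    finally have "(\<Prod>e\<in>F. u e) = tensor (a * xi 1 ^ (\<Sum>e\<in>F0. 2 ^ (e - 1))) (tau_prod F1)"
      using finF by (cases "0 \<in> F")
        (simp_all add: F0_def a_def u_def prod.remove[of F 0] tensor_mult)
    then have "L ((\<Prod>e\<in>F. u e) * (\<Prod>e\<in>E - F. tensor 1 (taus e))) =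
        pair (a * xi 1 ^ (\<Sum>e\<in>F0. 2 ^ (e - 1)) * etaR (pair (tau_prod (E - F) * tau_prod F1) ?P)) (sq m)"
      by (simp add: L_def tensor_prod tensor_mult act_tensor mult.commute)
    also have "pair (tau_prod (E - F) * tau_prod F1) ?P = carry_value n (E - F) F1"
      using n fin F0 by (intro pair_tau_prod_mult_P) (auto simp: Suc_F1 F0_def)
    also have "pair (a * xi 1 ^ (\<Sum>e\<in>F0. 2 ^ (e - 1)) * etaR (carry_value n (E - F) F1)) (sq m) =
        (\<Sum>j<n. if E - F = {j} \<and> F1 = {j..<n} then
          pair (a * xi 1 ^ (\<Sum>e\<in>F0. 2 ^ (e - 1)) * etaR (tau * rho ^ (n - 1 - j))) (sq m) else 0)"
      unfolding carry_value_def additive_sum[of etaR, OF etaR_simps(3)] sum_distrib_left pair_sum_left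
      by (intro sum.cong refl) auto
    also have "\<dots> = (\<Sum>j<n. if E - F = {j} \<and> F0 = {Suc j..n} then V j F else 0)"
    proof (intro sum.cong refl)
      fix j assume "j \<in> {..<n}"
      then have j: "j < n" by simp
      have "Suc ` {j..<n} = {Suc j..n}" by (simp add: image_Suc_atLeastLessThan atLeastLessThanSuc_atLeastAtMost)
      then have iff: "F1 = {j..<n} \<longleftrightarrow> F0 = {Suc j..n}"
        using Suc_F1 inj_image_eq_iff[of Suc F1 "{j..<n}"] by simp
      have "pair (a * xi 1 ^ (\<Sum>e\<in>F0. 2 ^ (e - 1)) * etaR (tau * rho ^ (n - 1 - j))) (sq m) = V j F"
        if "F0 = {Suc j..n}"
        using j unfolding that sum_powers_interval[OF less_imp_le[OF j]]
        by (cases "0 \<in> F") (simp_all only: a_def V_def if_True if_False mult_1_left pair_carry_sq simp_thms)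
      then show "(if E - F = {j} \<and> F1 = {j..<n} then
          pair (a * xi 1 ^ (\<Sum>e\<in>F0. 2 ^ (e - 1)) * etaR (tau * rho ^ (n - 1 - j))) (sq m) else 0) =
          (if E - F = {j} \<and> F0 = {Suc j..n} then V j F else 0)"
        by (simp only: iff) (simp del: eq_iff)
    qed
    finally show ?thesis by (simp only: F0_def)
  qed
  have "pair (tau_prod E) (sq m * ?P) = L (\<Prod>e\<in>E. Delta (taus e))"
    by (simp add: pair_product L_def Delta_simps)
  also have "\<dots> = L (\<Prod>e\<in>E. u e + tensor 1 (taus e))"
    by (intro mult_equivD mult_equiv_prod taus)
  also have "\<dots> = (\<Sum>F\<in>Pow E. L ((\<Prod>e\<in>F. u e) * (\<Prod>e\<in>E - F. tensor 1 (taus e))))"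
    using fin by (simp add: prod_add additive_sum[of L, OF L_add])
  also have "\<dots> = (\<Sum>F\<in>Pow E. \<Sum>j<n. if E - F = {j} \<and> F - {0} = {Suc j..n} then V j F else 0)"
    by (intro sum.cong refl L_term)
  also have "\<dots> = (\<Sum>j<n. \<Sum>F\<in>Pow E. if E - F = {j} \<and> F - {0} = {Suc j..n} then V j F else 0)"
    by (rule sum.swap)
  also have "\<dots> = (\<Sum>j<n.
      (if E = {j..n} \<and> m = 2 ^ n - 2 ^ j then tau * rho ^ (n - 1 - j) else 0)
      + (if j \<ge> 1 \<and> E = insert 0 {j..n} \<and> m = 2 ^ n - 2 ^ j + 1
         then tau * rho ^ (n - 1 - j + 1) else 0))"
    (is "_ = (\<Sum>j<n. ?A j + ?B j)")
  proof (intro sum.cong refl)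
    fix j assume "j \<in> {..<n}"
    then have j: "j < n" by simp
    have I: "{j..n} = insert j {Suc j..n}" using j by auto
    have "(if E - F = {j} \<and> F - {0} = {Suc j..n} then V j F else 0) =
        (if F = {Suc j..n} then ?A j else 0) + (if F = insert 0 {Suc j..n} then ?B j else 0)"
      if F: "F \<in> Pow E" for F
    proof (cases "0 \<in> F")
      case True
      then have "F \<noteq> {Suc j..n}" by auto
      moreover have "F - {0} = {Suc j..n} \<longleftrightarrow> F = insert 0 {Suc j..n}" using True by auto
      moreover have "E - F = {j} \<longleftrightarrow> j \<ge> 1 \<and> E = insert 0 {j..n}" if "F = insert 0 {Suc j..n}"
        using F that True I by (cases j) auto
      ultimately show ?thesis using True by (auto simp: V_def)
    next
      case False
      then have "F \<noteq> insert 0 {Suc j..n}" "F - {0} = F" by auto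
      moreover have "E - F = {j} \<longleftrightarrow> E = {j..n}" if "F = {Suc j..n}"
        using F that I by auto
      ultimately show ?thesis using False by (auto simp: V_def)
    qed
    then have "(\<Sum>F\<in>Pow E. if E - F = {j} \<and> F - {0} = {Suc j..n} then V j F else 0) =
        (\<Sum>F\<in>Pow E. (if F = {Suc j..n} then ?A j else 0) + (if F = insert 0 {Suc j..n} then ?B j else 0))"
      by (rule sum.cong[OF refl])
    also have "\<dots> = (if {Suc j..n} \<in> Pow E then ?A j else 0)
        + (if insert 0 {Suc j..n} \<in> Pow E then ?B j else 0)"
      using fin by (simp only: sum.distrib sum.delta finite_Pow_iff)
    also have "(if {Suc j..n} \<in> Pow E then ?A j else 0) = ?A j" by auto
    also have "(if insert 0 {Suc j..n} \<in> Pow E then ?B j else 0) = ?B j" by auto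
    finally show "(\<Sum>F\<in>Pow E. if E - F = {j} \<and> F - {0} = {Suc j..n} then V j F else 0) =
        ?A j + ?B j" .
  qed
  finally show ?thesis .
qed

subsection \<open>The commutator formula\<close>

lemma mult_iota_rho: "\<theta> * iota rho = iota rho * \<theta>"
  by (rule milnor_dual_ext)
     (simp add: pair_right pair_left pair_etaL etaR_one_one[OF rho_mem] mult.commute[of _ "etaL _"])

lemma mono_xi_power: "mono (E, xi_power k r) = xi k ^ r * tau_prod E"
  by (cases "r = 0") (simp_all add: milnor_monomial_def xi_power_def)

lemma pair_xi_power_hat_xi_power:
  assumes "finite E" "finite E'" "k \<ge> 1"
  shows "pair (xi k ^ r * tau_prod E) (hat (E', xi_power k s)) = (if E = E' \<and> r = s then 1 else 0)"
  using assms by (simp add: hat_dual milnor_indices_xi_power xi_power_eq_iff flip: mono_xi_power)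

lemma Sq_power: "Sq (2 ^ (k + 1)) = sq (2 ^ k)"
  using Sq_even[of "2 ^ k"] by (simp add: power_add mult.commute)

lemma Sq_power_diff: "Sq (2 ^ (k + 1) - 2) = sq (2 ^ k - 1)"
proof -
  have "2 ^ (k + 1) - 2 = 2 * (2 ^ k - 1 :: nat)" by (simp add: power_add diff_mult_distrib2 mult.commute)
  then show ?thesis by (simp only: Sq_even)
qed

lemma Q_list_mult_sq:
  "prod_list (map (milnor_Q hat) [j..<n + 1]) *
      (sq (2 ^ j) + iota rho * milnor_Q hat 0 * sq (2 ^ j - 1)) =
    hat ({j..n}, xi_power 1 (2 ^ j))
      + iota rho * (if j \<ge> 1 then hat (insert 0 {j..n}, xi_power 1 (2 ^ j - 1)) else 0)"
proof -
  let ?Q = "prod_list (map (milnor_Q hat) [j..<n + 1])"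
  have "{j..<n + 1} = {j..n}" by auto
  then have Q: "?Q * hat (E, xi_power 1 s) = (if {j..n} \<inter> E = {} then hat ({j..n} \<union> E, xi_power 1 s) else 0)"
    if "finite E" for E s
    using that milnor_Q_list_mult_hat[of E "xi_power 1 s" j "n + 1"]
    by (simp add: milnor_indices_xi_power)
  have "?Q * (iota rho * milnor_Q hat 0 * sq (2 ^ j - 1)) =
      iota rho * (?Q * (milnor_Q hat 0 * sq (2 ^ j - 1)))"
    by (simp only: mult.assoc mult_iota_rho[of ?Q, symmetric])
       (simp only: mult.assoc[symmetric] mult_iota_rho[of ?Q])
  also have "milnor_Q hat 0 * sq (2 ^ j - 1) = hat ({0}, xi_power 1 (2 ^ j - 1))"
    by (simp add: milnor_Q_mult_hat milnor_indices_xi_power)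
  also have "?Q * hat ({0}, xi_power 1 (2 ^ j - 1)) =
      (if j \<ge> 1 then hat (insert 0 {j..n}, xi_power 1 (2 ^ j - 1)) else 0)"
    by (subst Q) auto
  finally have rho: "?Q * (iota rho * milnor_Q hat 0 * sq (2 ^ j - 1)) =
      iota rho * (if j \<ge> 1 then hat (insert 0 {j..n}, xi_power 1 (2 ^ j - 1)) else 0)" .
  have "?Q * sq (2 ^ j) = hat ({j..n}, xi_power 1 (2 ^ j))"
    by (subst Q) auto
  then show ?thesis by (simp only: distrib_left rho)
qed

lemma commutator_P_sq:
  assumes n: "n \<ge> 1"
  shows "commutator (milnor_P hat n) (sq (2 ^ n)) =
      milnor_P hat (n + 1)
      + iota tau * hat ({0, n}, xi_power 1 (2 ^ n - 1))
      + (\<Sum>j<n. iota (tau * rho ^ (n - 1 - j)) * (hat ({j..n}, xi_power 1 (2 ^ j))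
          + iota rho * (if j \<ge> 1 then hat (insert 0 {j..n}, xi_power 1 (2 ^ j - 1)) else 0)))"
    (is "?C = ?P + iota tau * ?T + (\<Sum>j<n. iota (?c j) * (?A j + iota rho * ?B j))")
proof (rule milnor_dual_ext)
  fix M :: "nat set \<times> (nat \<Rightarrow> nat)" assume M: "M \<in> milnor_indices"
  obtain E R where M_eq: "M = (E, R)" by fastforce
  have fin: "finite E" and R0: "R 0 = 0" using M by (auto simp: M_eq milnor_indices_def)
  have rhs: "pair \<alpha> (?P + iota tau * ?T + (\<Sum>j<n. iota (?c j) * (?A j + iota rho * ?B j))) =
      pair \<alpha> ?P + tau * pair \<alpha> ?T + (\<Sum>j<n. ?c j * (pair \<alpha> (?A j) + rho * pair \<alpha> (?B j)))" for \<alpha>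
    by (simp add: pair_add_right pair_left pair_sum_right)
  show "pair (mono M) ?C =
      pair (mono M) (?P + iota tau * ?T + (\<Sum>j<n. iota (?c j) * (?A j + iota rho * ?B j)))"
  proof (cases "\<exists>k\<ge>2. R k \<noteq> 0")
    case True
    then obtain k where k: "k \<ge> 2" "R k \<noteq> 0" by blast
    define R' where "R' = R(k := R k - 1)"
    have "(E, R') \<in> milnor_indices" "R = R'(k := Suc (R' k))"
      using M k milnor_indices_upd[of E R k] by (auto simp: M_eq R'_def)
    then have mono: "mono M = xi k * mono (E, R')"
      by (simp add: M_eq xi_mult_mono)
    have zero: "pair (xi k * \<alpha>) (hat (E', xi_power 1 s)) = 0" if "finite E'" for \<alpha> E' s
      using k that by (simp add: pair_xi_hat milnor_indices_xi_power xi_power_apply)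
    show ?thesis
      unfolding rhs using n k
      by (simp add: mono pair_xi_commutator pair_xi_P zero if_distrib[of "pair _"] cong: if_cong)
  next
    case False
    define r where "r = R 1"
    have "R = xi_power 1 r"
    proof
      fix i
      show "R i = xi_power 1 r i"
        using False R0 by (cases "i = 0"; cases "i = 1") (auto simp: xi_power_def r_def)
    qed
    then have mono: "mono M = xi 1 ^ r * tau_prod E"
      by (simp add: M_eq mono_xi_power)
    let ?m = "2 ^ n - r"
    have pow: "2 ^ j \<le> (2::nat) ^ n \<and> (1::nat) \<le> 2 ^ j" if "j < n" for j
      using that by (simp add: power_increasing)
    have "R (n + 1) \<noteq> xi_power (n + 1) 1 (n + 1)"
      using n \<open>R = xi_power 1 r\<close> by (simp add: xi_power_apply)
    then have "R \<noteq> xi_power (n + 1) 1" by metis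
    then have P: "pair (mono M) ?P = 0"
      using hat_dual[OF M, of "({}, xi_power (n + 1) 1)"]
      by (simp add: milnor_P_def milnor_indices_xi_power M_eq)
    have T: "tau * pair (mono M) ?T = (if r \<le> 2 ^ n \<and> E = {0, n} \<and> ?m = 1 then tau else 0)"
    proof -
      have "r = 2 ^ n - 1 \<longleftrightarrow> r \<le> 2 ^ n \<and> ?m = 1" using one_le_power[of "2::nat" n] by arith
      then show ?thesis using fin by (auto simp: mono pair_xi_power_hat_xi_power)
    qed
    have AB: "?c j * (pair (mono M) (?A j) + rho * pair (mono M) (?B j)) =
        (if r \<le> 2 ^ n then
          (if E = {j..n} \<and> ?m = 2 ^ n - 2 ^ j then ?c j else 0)
          + (if j \<ge> 1 \<and> E = insert 0 {j..n} \<and> ?m = 2 ^ n - 2 ^ j + 1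
             then tau * rho ^ (n - 1 - j + 1) else 0) else 0)" if j: "j \<in> {..<n}" for j
    proof -
      have "r = 2 ^ j \<longleftrightarrow> r \<le> 2 ^ n \<and> ?m = 2 ^ n - 2 ^ j"
        "r = 2 ^ j - 1 \<longleftrightarrow> r \<le> 2 ^ n \<and> ?m = 2 ^ n - 2 ^ j + 1"
        using pow[of j] j unfolding lessThan_iff by arith+
      then have "pair (mono M) (?A j) = (if r \<le> 2 ^ n \<and> E = {j..n} \<and> ?m = 2 ^ n - 2 ^ j then 1 else 0)"
        "pair (mono M) (?B j) = (if j \<ge> 1 \<and> r \<le> 2 ^ n \<and> E = insert 0 {j..n} \<and>
            ?m = 2 ^ n - 2 ^ j + 1 then 1 else 0)"
        using fin by (auto simp: mono pair_xi_power_hat_xi_power simp del: prod.insert)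
      then show ?thesis
        by (simp only: distrib_left) (simp add: mult_ac power_add)
    qed
    have "pair (mono M) ?C = (if r \<le> 2 ^ n then pair (tau_prod E) (commutator (milnor_P hat n) (sq ?m)) else 0)"
      using n by (simp add: mono pair_xi1_power_commutator)
    also have "\<dots> = tau * pair (mono M) ?T
        + (\<Sum>j<n. ?c j * (pair (mono M) (?A j) + rho * pair (mono M) (?B j)))"
    proof (cases "r \<le> 2 ^ n")
      case True
      show ?thesis
        by (simp only: T AB True if_True simp_thms pair_commutator pair_tau_prod_P_sq[OF n fin]
            pair_tau_prod_sq_P[OF n fin] cong: sum.cong)
    next
      case False
      show ?thesis by (simp only: T AB False if_False simp_thms sum.neutral_const add_0 cong: sum.cong)
    qed
    finally show ?thesis unfolding rhs P by simp
  qed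
qed

end

theorem mainTheorem4:
  fixes H :: "int \<Rightarrow> int \<Rightarrow> 'h::comm_ring_1 set"
    and etaL etaR :: "'h \<Rightarrow> 'a::comm_ring_1"
    and tensor :: "'a \<Rightarrow> 'a \<Rightarrow> 't::comm_ring_1"
    and tau rho :: 'h
    and taus xi :: "nat \<Rightarrow> 'a"
    and eps :: "'a \<Rightarrow> 'h"
    and Delta :: "'a \<Rightarrow> 't"
    and iota :: "'h \<Rightarrow> 's::ring_1"
    and pair :: "'a \<Rightarrow> 's \<Rightarrow> 'h"
    and hat :: "nat set \<times> (nat \<Rightarrow> nat) \<Rightarrow> 's"
    and Sq :: "nat \<Rightarrow> 's"
    and n :: nat
  assumes "motivic_steenrod_algebra H etaL etaR tensor tau rho taus xi eps Delta iota pair hat Sq"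
    and "n \<ge> 1"
  shows "commutator (milnor_P hat n) (Sq (2 ^ (n + 1))) =
      milnor_P hat (n + 1)
      + iota tau * milnor_Q hat n * milnor_Q hat 0 * Sq (2 ^ (n + 1) - 2)
      + (\<Sum>i = 0..n - 1. iota (tau * rho ^ i) *
           prod_list (map (milnor_Q hat) [n - i - 1..<n + 1]) *
           (Sq (2 ^ (n - i)) + iota rho * milnor_Q hat 0 * Sq (2 ^ (n - i) - 2)))"
proof -
  interpret motivic_steenrod_algebra H etaL etaR tensor tau rho taus xi eps Delta iota pair hat Sq
    by fact
  let ?Q = "milnor_Q hat"
  have "iota tau * ?Q n * ?Q 0 * Sq (2 ^ (n + 1) - 2) =
      iota tau * (?Q n * (?Q 0 * sq (2 ^ n - 1)))"
    by (simp only: Sq_power_diff mult.assoc)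
  also have "\<dots> = iota tau * hat ({0, n}, xi_power 1 (2 ^ n - 1))"
    using \<open>n \<ge> 1\<close> by (simp add: milnor_Q_mult_hat milnor_indices_xi_power insert_commute)
  finally have T: "iota tau * ?Q n * ?Q 0 * Sq (2 ^ (n + 1) - 2) =
      iota tau * hat ({0, n}, xi_power 1 (2 ^ n - 1))" .
  let ?f = "\<lambda>j. iota (tau * rho ^ (n - 1 - j)) * (hat ({j..n}, xi_power 1 (2 ^ j))
      + iota rho * (if j \<ge> 1 then hat (insert 0 {j..n}, xi_power 1 (2 ^ j - 1)) else 0))"
  have "(\<Sum>i = 0..n - 1. iota (tau * rho ^ i) * prod_list (map ?Q [n - i - 1..<n + 1]) *
      (Sq (2 ^ (n - i)) + iota rho * ?Q 0 * Sq (2 ^ (n - i) - 2))) = (\<Sum>i<n. ?f (n - Suc i))"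
  proof (rule sum.cong)
    show "{0..n - 1} = {..<n}" using \<open>n \<ge> 1\<close> by auto
    fix i assume "i \<in> {..<n}"
    then have i: "n - i = n - i - 1 + 1" "n - 1 - (n - i - 1) = i" by auto
    have Sq: "Sq (2 ^ (n - i)) = sq (2 ^ (n - i - 1))"
      "Sq (2 ^ (n - i) - 2) = sq (2 ^ (n - i - 1) - 1)"
      using Sq_power[of "n - i - 1"] Sq_power_diff[of "n - i - 1"] i(1) by metis+
    have "iota (tau * rho ^ i) * prod_list (map ?Q [n - i - 1..<n + 1]) *
        (Sq (2 ^ (n - i)) + iota rho * ?Q 0 * Sq (2 ^ (n - i) - 2)) =
        iota (tau * rho ^ i) * (prod_list (map ?Q [n - i - 1..<n + 1]) *
        (sq (2 ^ (n - i - 1)) + iota rho * ?Q 0 * sq (2 ^ (n - i - 1) - 1)))"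
      by (simp only: Sq mult.assoc)
    also have "\<dots> = ?f (n - i - 1)"
      by (simp only: Q_list_mult_sq i(2))
    finally show "iota (tau * rho ^ i) * prod_list (map ?Q [n - i - 1..<n + 1]) *
        (Sq (2 ^ (n - i)) + iota rho * ?Q 0 * Sq (2 ^ (n - i) - 2)) = ?f (n - Suc i)"
      by (simp only: diff_Suc_1 diff_diff_left Suc_eq_plus1)
  qed
  also have "\<dots> = (\<Sum>j<n. ?f j)" by (rule sum.nat_diff_reindex)
  finally show ?thesis
    using commutator_P_sq[OF \<open>n \<ge> 1\<close>] by (simp only: T Sq_power)
qed

end
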